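(* Every $TB$-sequence of integers is a rigidity sequence. That is: if $(n_k)_{k\ge 0}$ is a sequence of integers for which there exists a precompact group topology $\tau$ on $\mathbb{Z}$ such that $n_k\to 0$ with respect to $\tau$ as $k\to\infty$, then $(n_k)_{k\ge 0}$ is a rigidity sequence.
   Context: $\mathbb{T}=\{z\in\mathbb{C}: |z|=1\}$. $\mathcal{P}_c(\mathbb{T})$ is the set of Borel probability measures $\mu$ on $\mathbb{T}$ with $\mu(\{z\})=0$ for every $z\in\mathbb{T}$. For $n\in\mathbb{Z}$, $\widehat{\mu}(n)=\int_{\mathbb{T}} z^n\,d\mu(z)$. Rigidity sequence: a sequence of integers $(n_k)_{k\ge 0}$ is a rigidity sequence if there exists $\mu\in\mathcal{P}_c(\mathbb{T})$ such that $\widehat{\mu}(n_k)\to 1$ as $k\to\infty$. (For sequences of positive integers this is known to be equivalent to the existence of a weakly mixing measure-preserving system $(X,\mathcal{B},m;T)$ on a probability space such that $m(T^{-n_k}A\,\Delta\,A)\to 0$ for every $A\in\mathcal{B}$.) Precompact: a Hausdorff topological group $(G,+)$ is precompact if for every non-empty open set $U\subseteq G$ there is a finite set $F\subseteq G$ with $G=U+F$. A precompact group topology on $\mathbb{Z}$ is a Hausdorff group topology making $\mathbb{Z}$ a precompact topological group. A sequence of integers is a $TB$-sequence (totally bounded sequence) if it converges to $0$ for some precompact group topology on $\mathbb{Z}$. *)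

theory Defs
  imports "HOL-Probability.Probability"
begin

definition group_topology :: "'a::ab_group_add topology \<Rightarrow> bool" where
  "group_topology \<tau> \<longleftrightarrow>
     topspace \<tau> = UNIV \<and>
     continuous_map (prod_topology \<tau> \<tau>) \<tau> (\<lambda>(x, y). x + y) \<and>
     continuous_map \<tau> \<tau> (\<lambda>x. - x)"

definition precompact_group_topology :: "'a::ab_group_add topology \<Rightarrow> bool" where
  "precompact_group_topology \<tau> \<longleftrightarrow>
     group_topology \<tau> \<and> Hausdorff_space \<tau> \<and>
     (\<forall>U. openin \<tau> U \<and> U \<noteq> {} \<longrightarrow>
        (\<exists>F. finite F \<and> {u + f |u f. u \<in> U \<and> f \<in> F} = UNIV))"

definition TB_sequence :: "(nat \<Rightarrow> int) \<Rightarrow> bool" where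
  "TB_sequence n \<longleftrightarrow>
     (\<exists>\<tau>. precompact_group_topology \<tau> \<and> limitin \<tau> n 0 sequentially)"

definition unit_circle :: "complex set" where
  "unit_circle = {z. cmod z = 1}"

definition continuous_prob_measures_circle :: "complex measure set" where
  "continuous_prob_measures_circle =
     {\<mu>. prob_space \<mu> \<and> sets \<mu> = sets (restrict_space borel unit_circle) \<and>
         (\<forall>z\<in>unit_circle. measure \<mu> {z} = 0)}"

definition fourier_coeff :: "complex measure \<Rightarrow> int \<Rightarrow> complex" where
  "fourier_coeff \<mu> n = (\<integral>z. z powi n \<partial>\<mu>)"

definition rigidity_sequence :: "(nat \<Rightarrow> int) \<Rightarrow> bool" where
  "rigidity_sequence n \<longleftrightarrow>
     (\<exists>\<mu>\<in>continuous_prob_measures_circle.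
        (\<lambda>k. fourier_coeff \<mu> (n k)) \<longlonglongrightarrow> 1)"

end

theory Submission
  imports Defs
begin

text \<open>
  Let \<open>H\<close> be the group of all real \<open>t\<close> with \<open>cis (n k * t) \<longlonglongrightarrow> 1\<close>.

  If \<open>H\<close> contains arbitrarily small positive numbers, choose \<open>\<theta> i \<in> H\<close> decreasing so fast that for every
  \<open>k\<close> at most one \<open>\<theta> i\<close> has \<open>cis (n k * \<theta> i)\<close> at distance more than \<open>(1/2) ^ i\<close> from \<open>1\<close>. For sets
  \<open>I i \<subseteq> [0,1)\<close> that separate points and whose lengths tend to \<open>0\<close>, the map \<open>x \<mapsto> cis (\<Sum>i. \<theta> i * 1\<^bsub>I i\<^esub> x)\<close>
  is injective, so it sends Lebesgue measure to a continuous measure; the single bad index \<open>b k\<close> only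
  matters on \<open>I (b k)\<close>, whose length tends to \<open>0\<close>.

  Otherwise \<open>H\<close> is discrete and some \<open>q > 0\<close> satisfies \<open>cis (q * t) = 1\<close> on \<open>H\<close>. The topology yields an
  invariant continuous pseudonorm \<open>p\<close> with \<open>p q \<ge> 1/2\<close>. A spectral measure \<open>\<mu>\<close> of \<open>1 + p\<close> has
  \<open>\<integral> \<bar>z ^ m - 1\<bar>\<^sup>2 d\<mu> \<le> (p m)\<^sup>2\<close> for all \<open>m\<close>, so its Fourier coefficients along \<open>n\<close> tend to \<open>1\<close> and all its
  atoms lie in \<open>H\<close>; by precompactness the same integral is positive for \<open>m = q\<close>, so \<open>\<mu>\<close> charges the
  set \<open>cis (q * t) \<noteq> 1\<close>. Restricting \<open>\<mu>\<close> to this set and normalising gives the continuous measure.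
\<close>

section \<open>Rigidity from the law of a random angle\<close>

text \<open>The measure on the circle is the law of \<open>cis (X x)\<close>. A criterion in
  \<open>1 - cos\<close> alone suffices, because the imaginary part of a Fourier coefficient is
  controlled by the defect of its real part; later constructions thus need only real integrals of
  nonnegative functions.\<close>

lemma rigidity_sequenceI:
  fixes n :: "nat \<Rightarrow> int" and X :: "'a \<Rightarrow> real"
  assumes "prob_space M" and X [measurable]: "X \<in> borel_measurable M"
    and atomless: "\<And>z. measure M {x \<in> space M. cis (X x) = z} = 0"
    and lim: "(\<lambda>k. \<integral>x. 1 - cos (n k * X x) \<partial>M) \<longlonglongrightarrow> 0"
  shows "rigidity_sequence n"
proof -
  interpret prob_space M by fact
  let ?C = "restrict_space borel unit_circle :: complex measure"
  define \<mu> where "\<mu> = distr M ?C (\<lambda>x. cis (X x))"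
  have cis_meas [measurable]: "(\<lambda>x. cis (f x)) \<in> borel_measurable M" if [measurable]: "f \<in> borel_measurable M" for f
    by (intro borel_measurable_continuous_on[where f=cis] that continuous_intros)
  have meas: "(\<lambda>x. cis (X x)) \<in> measurable M ?C"
    by (rule measurable_restrict_space2) (auto simp: unit_circle_def)
  have powi_meas: "(\<lambda>z. z powi i) \<in> borel_measurable ?C" for i
    by (rule measurable_restrict_space1) (cases "i \<ge> 0"; simp add: power_int_def)
  have coeff: "fourier_coeff \<mu> i = (\<integral>x. cis (i * X x) \<partial>M)" for i
    unfolding fourier_coeff_def \<mu>_def by (subst integral_distr[OF meas powi_meas]) (simp add: cis_power_int)
  have int_cis: "integrable M (\<lambda>x. cis (i * X x))" for i :: int
    by (rule integrable_const_bound[where B=1]) auto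
  have int_cos: "integrable M (\<lambda>x. cos (i * X x))" and int_sin: "integrable M (\<lambda>x. sin (i * X x))"
    and int_sin2: "integrable M (\<lambda>x. (sin (i * X x))\<^sup>2)" for i :: int
    by (rule integrable_const_bound[where B=1]; auto simp: abs_square_le_1)+
  have Re: "Re (fourier_coeff \<mu> i) = 1 - (\<integral>x. 1 - cos (i * X x) \<partial>M)" for i
    using integral_Re[OF int_cis[of i]] int_cos[of i] by (simp add: coeff prob_space)
  have Im: "Im (fourier_coeff \<mu> i) = (\<integral>x. sin (i * X x) \<partial>M)" for i
    using integral_Im[OF int_cis[of i]] by (simp add: coeff)
  have Im_le: "(Im (fourier_coeff \<mu> i))\<^sup>2 \<le> 2 * (\<integral>x. 1 - cos (i * X x) \<partial>M)" for i
  proof -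
    \<comment> \<open>The variance of \<open>sin (i * X x)\<close> is nonnegative.\<close>
    have "(Im (fourier_coeff \<mu> i))\<^sup>2 \<le> (\<integral>x. (sin (i * X x))\<^sup>2 \<partial>M)"
      using variance_positive[of "\<lambda>x. sin (i * X x)"] variance_eq[OF int_sin int_sin2, of i]
      unfolding Im by linarith
    also have "\<dots> \<le> (\<integral>x. 2 * (1 - cos (i * X x)) \<partial>M)"
    proof (intro integral_mono int_sin2)
      fix x
      have "(sin (i * X x))\<^sup>2 = (1 - cos (i * X x)) * (1 + cos (i * X x))"
        by (simp add: sin_squared_eq algebra_simps power2_eq_square)
      also have "\<dots> \<le> (1 - cos (i * X x)) * 2"
        by (intro mult_left_mono) auto
      finally show "(sin (i * X x))\<^sup>2 \<le> 2 * (1 - cos (i * X x))" by simp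
    qed (use int_cos in auto)
    finally show ?thesis by (simp only: integral_mult_right_zero)
  qed
  have "(\<lambda>k. (Im (fourier_coeff \<mu> (n k)))\<^sup>2) \<longlonglongrightarrow> 0"
    by (rule tendsto_sandwich[OF _ _ tendsto_const tendsto_mult_right_zero[OF lim, of 2]])
       (use Im_le in auto)
  then have "(\<lambda>k. Im (fourier_coeff \<mu> (n k))) \<longlonglongrightarrow> 0"
    using tendsto_real_sqrt[of _ 0] by (simp add: real_sqrt_abs tendsto_rabs_zero_iff)
  moreover have "(\<lambda>k. Re (fourier_coeff \<mu> (n k))) \<longlonglongrightarrow> 1"
    unfolding Re using tendsto_diff[OF tendsto_const lim, of 1] by simp
  ultimately have "(\<lambda>k. fourier_coeff \<mu> (n k)) \<longlonglongrightarrow> 1"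
    by (simp add: tendsto_complex_iff)
  moreover have "\<mu> \<in> continuous_prob_measures_circle"
  proof -
    have "measure \<mu> {z} = 0" if "z \<in> unit_circle" for z
    proof -
      have "{z} \<in> sets ?C" using that by (simp add: sets_restrict_space_iff unit_circle_def)
      then show ?thesis using atomless[of z]
        by (simp add: \<mu>_def measure_distr[OF meas] vimage_def Int_def conj_commute)
    qed
    then show ?thesis
      using prob_space_distr[OF meas] by (simp add: continuous_prob_measures_circle_def \<mu>_def)
  qed
  ultimately show ?thesis unfolding rigidity_sequence_def by blast
qed

section \<open>A continuous pseudonorm\<close>

text \<open>The combinatorial core of the Birkhoff--Kakutani construction. The list is cut at the
  entry where the running weight first exceeds half the total: the pieces before and after it have
  at most half the weight and fall under the induction hypothesis one level deeper, and the entry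
  itself is that deep because its own weight is below \<open>(1/2) ^ m\<close>.\<close>

lemma sumset_chain:
  fixes U :: "nat \<Rightarrow> 'a::ab_group_add set"
  assumes zero: "\<And>i. 0 \<in> U i"
    and triple: "\<And>i x y z. x \<in> U (Suc i) \<Longrightarrow> y \<in> U (Suc i) \<Longrightarrow> z \<in> U (Suc i) \<Longrightarrow> x + y + z \<in> U i"
    and "(\<Sum>p\<leftarrow>ps. (1/2) ^ fst p) < (1/2 :: real) ^ m"
    and "\<And>p. p \<in> set ps \<Longrightarrow> snd p \<in> U (fst p)"
  shows "(\<Sum>p\<leftarrow>ps. snd p) \<in> U m"
  using assms(3,4)
proof (induction "length ps" arbitrary: ps m rule: less_induct)
  case less
  have anti: "U j \<subseteq> U i" if "i \<le> j" for i j
    using lift_Suc_antimono_le[of U, OF _ that] triple[OF _ zero zero] by fastforce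
  let ?w = "\<lambda>ps :: (nat \<times> 'a) list. (\<Sum>p\<leftarrow>ps. (1/2 :: real) ^ fst p)"
  have nonneg: "0 \<le> ?w qs" for qs by (rule sum_list_nonneg) auto
  show ?case
  proof (cases "ps = []")
    case True
    then show ?thesis using zero by simp
  next
    case False
    \<comment> \<open>Position of the pivot: \<open>take k ps\<close> still weighs at most half,
      \<open>take (Suc k) ps\<close> more than half.\<close>
    define k where "k = (LEAST k. ?w ps / 2 < ?w (take (Suc k) ps))"
    have pos: "?w ps > 0" using False nonneg by (cases ps) (auto intro!: add_pos_nonneg)
    have ex: "?w ps / 2 < ?w (take (Suc (length ps - 1)) ps)" using False pos by simp
    have k: "?w ps / 2 < ?w (take (Suc k) ps)" unfolding k_def by (rule LeastI[of _ "length ps - 1"]) (rule ex)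
    have "k \<le> length ps - 1" unfolding k_def by (rule Least_le) (rule ex)
    with False have klen: "k < length ps" by (cases ps) auto
    have pre: "?w (take k ps) \<le> ?w ps / 2"
    proof (cases k)
      case (Suc j)
      then show ?thesis using not_less_Least[of j "\<lambda>k. ?w ps / 2 < ?w (take (Suc k) ps)"] by (simp add: k_def)
    qed (use pos in simp)
    have split: "ps = take k ps @ ps ! k # drop (Suc k) ps" using klen by (simp add: id_take_nth_drop)
    have w: "?w ps = ?w (take k ps) + (1/2) ^ fst (ps ! k) + ?w (drop (Suc k) ps)"
      by (subst split) simp
    have "?w (take (Suc k) ps) = ?w (take k ps) + (1/2) ^ fst (ps ! k)"
      using klen by (simp add: take_Suc_conv_app_nth)
    with k w have suf: "?w (drop (Suc k) ps) < ?w ps / 2" by linarith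
    have half: "?w ps / 2 < (1/2) ^ Suc m" using less.prems(1) by simp
    have 1: "(\<Sum>p\<leftarrow>take k ps. snd p) \<in> U (Suc m)"
      using pre half klen by (intro less.hyps) (auto intro!: less.prems(2) dest: in_set_takeD)
    have 2: "(\<Sum>p\<leftarrow>drop (Suc k) ps. snd p) \<in> U (Suc m)"
      using suf half klen by (intro less.hyps) (auto intro!: less.prems(2) dest: in_set_dropD)
    have "(1/2 :: real) ^ fst (ps ! k) < (1/2) ^ m"
      using w nonneg[of "take k ps"] nonneg[of "drop (Suc k) ps"] less.prems(1) by linarith
    then have "m < fst (ps ! k)" by (simp add: power_strict_decreasing_iff)
    then have 3: "snd (ps ! k) \<in> U (Suc m)"
      using less.prems(2)[of "ps ! k"] klen anti[of "Suc m"] by (auto simp: Suc_le_eq)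
    show ?thesis using triple[OF 1 3 2] by (subst split) (simp add: add.assoc)
  qed
qed

text \<open>Continuity of addition at zero is used twice, and the third summand is absorbed since
  \<open>V2\<close> lies in \<open>V1\<close>. Three summands match prefix, pivot and suffix in
  \<open>sumset_chain\<close>.\<close>

lemma group_topology_zero_nbhd:
  fixes \<tau> :: "'a::ab_group_add topology"
  assumes "group_topology \<tau>" "openin \<tau> W" "0 \<in> W"
  obtains V where "openin \<tau> V" "0 \<in> V" "\<And>x. x \<in> V \<Longrightarrow> - x \<in> V"
    "\<And>x y z. x \<in> V \<Longrightarrow> y \<in> V \<Longrightarrow> z \<in> V \<Longrightarrow> x + y + z \<in> W"
proof -
  have top: "topspace \<tau> = UNIV" and add: "continuous_map (prod_topology \<tau> \<tau>) \<tau> (\<lambda>(x, y). x + y)"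
    and minus: "continuous_map \<tau> \<tau> uminus"
    using assms(1) by (auto simp: group_topology_def)
  have halve: "\<exists>V. openin \<tau> V \<and> 0 \<in> V \<and> (\<forall>x\<in>V. \<forall>y\<in>V. x + y \<in> W)" if W: "openin \<tau> W" "0 \<in> W" for W
  proof -
    have "openin (prod_topology \<tau> \<tau>) {u. (case u of (x, y) \<Rightarrow> x + y) \<in> W}"
      using openin_continuous_map_preimage[OF add W(1)] by (simp add: top)
    then obtain V1 V2 where "openin \<tau> V1" "openin \<tau> V2" "0 \<in> V1" "0 \<in> V2"
      "V1 \<times> V2 \<subseteq> {u. (case u of (x, y) \<Rightarrow> x + y) \<in> W}"
      using W(2) unfolding openin_prod_topology_alt by (elim allE[of _ 0]) auto
    then show ?thesis by (intro exI[of _ "V1 \<inter> V2"]) auto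
  qed
  obtain V1 where V1: "openin \<tau> V1" "0 \<in> V1" "\<And>x y. x \<in> V1 \<Longrightarrow> y \<in> V1 \<Longrightarrow> x + y \<in> W"
    using halve[OF assms(2,3)] by blast
  obtain V2 where V2: "openin \<tau> V2" "0 \<in> V2" "\<And>x y. x \<in> V2 \<Longrightarrow> y \<in> V2 \<Longrightarrow> x + y \<in> V1"
    using halve[OF V1(1,2)] by blast
  have V2V1: "x \<in> V1" if "x \<in> V2" for x using V2(3)[OF that V2(2)] by simp
  show thesis
  proof (rule that[of "V2 \<inter> {x. - x \<in> V2}"])
    show "openin \<tau> (V2 \<inter> {x. - x \<in> V2})"
      using openin_continuous_map_preimage[OF minus V2(1)] V2(1) by (auto simp: top)
  qed (use V1 V2 V2V1 in auto)
qed

text \<open>The Birkhoff--Kakutani construction.\<close>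
lemma group_topology_pseudonorm:
  fixes \<tau> :: "'a::ab_group_add topology"
  assumes "group_topology \<tau>" "Hausdorff_space \<tau>" "q \<noteq> 0"
  obtains p :: "'a \<Rightarrow> real" where "\<And>x. 0 \<le> p x" "\<And>x. p x \<le> 1" "\<And>x y. \<bar>p (x + y) - p x\<bar> \<le> p y"
    "p q \<ge> 1 / 2" "\<And>e. e > 0 \<Longrightarrow> \<exists>V. openin \<tau> V \<and> 0 \<in> V \<and> (\<forall>x\<in>V. p x < e)"
proof -
  have top: "topspace \<tau> = UNIV" using assms(1) by (auto simp: group_topology_def)
  obtain W where W: "openin \<tau> W" "0 \<in> W" "q \<notin> W"
    using assms(2,3) unfolding Hausdorff_space_def by (metis top UNIV_I disjnt_iff)
  define nbhd where "nbhd V \<longleftrightarrow> openin \<tau> V \<and> 0 \<in> V \<and> (\<forall>x\<in>V. - x \<in> V)" for V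
  define thrice where "thrice V W \<longleftrightarrow> (\<forall>x\<in>V. \<forall>y\<in>V. \<forall>z\<in>V. x + y + z \<in> W)" for V W :: "'a set"
  have shrink: "\<exists>V. nbhd V \<and> thrice V W'" if "openin \<tau> W'" "0 \<in> W'" for W'
    by (rule group_topology_zero_nbhd[OF assms(1) that]) (auto simp: nbhd_def thrice_def)
  obtain W1 where W1: "nbhd W1" "q \<notin> W1"
  proof -
    obtain V where V: "nbhd V" "thrice V W" using shrink[OF W(1,2)] by blast
    then have "q + 0 + 0 \<in> W" if "q \<in> V" using that unfolding nbhd_def thrice_def by blast
    with V(1) W(3) show thesis using that[of V] by auto
  qed
  \<comment> \<open>The choice \<open>U 0 = UNIV\<close> gives every element a representation and
    bounds \<open>p\<close> by 1; keeping \<open>q\<close> out of \<open>U 1\<close> will give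
    \<open>p q \<ge> 1 / 2\<close>.\<close>
  have "\<exists>U. \<forall>i. nbhd (U i) \<and> thrice (U (Suc i)) (U i) \<and> (i = 1 \<longrightarrow> q \<notin> U i) \<and> (i = 0 \<longrightarrow> U i = UNIV)"
  proof -
    have "\<exists>U. \<forall>i. (nbhd (U i) \<and> (i = 1 \<longrightarrow> q \<notin> U i) \<and> (i = 0 \<longrightarrow> U i = UNIV)) \<and> thrice (U (Suc i)) (U i)"
    proof (rule dependent_nat_choice)
      show "\<exists>V. nbhd V \<and> ((0::nat) = 1 \<longrightarrow> q \<notin> V) \<and> ((0::nat) = 0 \<longrightarrow> V = UNIV)"
        using openin_topspace[of \<tau>] by (auto simp: nbhd_def top)
      fix V and i :: nat
      assume V: "nbhd V \<and> (i = 1 \<longrightarrow> q \<notin> V) \<and> (i = 0 \<longrightarrow> V = UNIV)"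
      show "\<exists>V'. (nbhd V' \<and> (Suc i = 1 \<longrightarrow> q \<notin> V') \<and> (Suc i = 0 \<longrightarrow> V' = UNIV)) \<and> thrice V' V"
      proof (cases "i = 0")
        case True
        then show ?thesis using V W1 by (auto simp: thrice_def)
      next
        case False
        then show ?thesis using shrink[of V] V by (auto simp: nbhd_def)
      qed
    qed
    then show ?thesis by blast
  qed
  then obtain U where U: "\<And>i. nbhd (U i)" "\<And>i. thrice (U (Suc i)) (U i)" "q \<notin> U 1" "U 0 = UNIV"
    by metis
  \<comment> \<open>An entry \<open>(i, y)\<close> uses an element \<open>y\<close> of
    \<open>U i\<close> at the price \<open>(1/2) ^ i\<close>; \<open>p x\<close> is the infimum of
    the prices of writing \<open>x\<close> as a finite sum.\<close>
  define w where "w ps = (\<Sum>p\<leftarrow>ps. (1/2 :: real) ^ fst p)" for ps :: "(nat \<times> 'a) list"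
  define reps where "reps x = {ps. (\<Sum>p\<leftarrow>ps. snd p) = x \<and> (\<forall>p\<in>set ps. snd p \<in> U (fst p))}" for x
  define p where "p x = (INF ps\<in>reps x. w ps)" for x
  have nonneg: "0 \<le> w ps" for ps unfolding w_def by (rule sum_list_nonneg) auto
  have bdd: "bdd_below (w ` A)" for A by (rule bdd_belowI2[of _ 0]) (rule nonneg)
  have single: "[(i, x)] \<in> reps x" if "x \<in> U i" for i x using that by (simp add: reps_def)
  have ne: "reps x \<noteq> {}" for x using single[of x 0] U(4) by auto
  have p_le: "p x \<le> w ps" if "ps \<in> reps x" for x ps
    unfolding p_def by (rule cINF_lower[OF bdd that])
  have p_ge: "c \<le> p x" if "\<And>ps. ps \<in> reps x \<Longrightarrow> c \<le> w ps" for x c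
    unfolding p_def by (rule cINF_greatest[OF ne that])
  have p_U: "p x \<le> (1/2) ^ i" if "x \<in> U i" for x i
    using p_le[OF single[OF that]] by (simp add: w_def)
  have subadd: "p (x + y) \<le> p x + p y" for x y
  proof -
    have *: "p (x + y) \<le> w ps + w qs" if "ps \<in> reps x" "qs \<in> reps y" for ps qs
      using p_le[of "ps @ qs" "x + y"] that by (auto simp: reps_def w_def)
    have "p (x + y) - p x \<le> w qs" if "qs \<in> reps y" for qs
      using p_ge[of x "p (x + y) - w qs"] * that by fastforce
    then show ?thesis using p_ge[of y "p (x + y) - p x"] by fastforce
  qed
  have uminus_le: "p (- x) \<le> p x" for x
  proof (rule p_ge)
    fix ps assume ps: "ps \<in> reps x"
    have sum: "(\<Sum>p\<leftarrow>ps. - snd p) = - (\<Sum>p\<leftarrow>ps. snd p)" for ps :: "(nat \<times> 'a) list"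
      by (induction ps) auto
    have "map (\<lambda>(i, y). (i, - y)) ps \<in> reps (- x)"
      using ps U(1) sum[of ps] unfolding reps_def nbhd_def by (fastforce simp: comp_def case_prod_unfold)
    from p_le[OF this] show "p (- x) \<le> w ps" by (simp add: w_def comp_def case_prod_unfold)
  qed
  show thesis
  proof
    show "0 \<le> p x" for x by (rule p_ge) (rule nonneg)
    show "p x \<le> 1" for x using p_U[of x 0] U(4) by simp
    show "\<bar>p (x + y) - p x\<bar> \<le> p y" for x y
      using subadd[of x y] subadd[of "x + y" "- y"] uminus_le[of y] by auto
    show "1 / 2 \<le> p q"
    proof (rule p_ge, rule ccontr)
      fix ps assume ps: "ps \<in> reps q" "\<not> 1 / 2 \<le> w ps"
      \<comment> \<open>By \<open>sumset_chain\<close> with \<open>m = 1\<close>, a representation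
        cheaper than \<open>1 / 2\<close> would put \<open>q\<close> into
        \<open>U 1\<close>.\<close>
      have "(\<Sum>p\<leftarrow>ps. snd p) \<in> U 1"
        by (rule sumset_chain) (use U(1,2) ps in \<open>auto simp: nbhd_def thrice_def reps_def w_def\<close>)
      with ps(1) U(3) show False by (simp add: reps_def)
    qed
    fix e :: real assume "e > 0"
    then obtain i where "(1/2 :: real) ^ i < e" using real_arch_pow_inv[of e "1/2"] by auto
    then show "\<exists>V. openin \<tau> V \<and> 0 \<in> V \<and> (\<forall>x\<in>V. p x < e)"
      using U(1)[of i] p_U[of _ i] by (intro exI[of _ "U i"]) (fastforce simp: nbhd_def)
  qed
qed

section \<open>Spectral measures\<close>

lemma sum_cis_roots_of_unity:
  fixes m :: int and N :: nat
  assumes "N > 0"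
  shows "(\<Sum>j<N. cis (2 * pi * real j * m / N)) = (if int N dvd m then of_nat N else 0)"
proof -
  define z where "z = cis (2 * pi * m / N)"
  have sum: "(\<Sum>j<N. cis (2 * pi * real j * m / N)) = (\<Sum>j<N. z ^ j)"
    unfolding z_def Complex.DeMoivre by (intro sum.cong refl arg_cong[where f=cis]) simp
  have zN: "z ^ N = 1"
    using assms by (simp add: z_def Complex.DeMoivre)
  show ?thesis
  proof (cases "int N dvd m")
    case True
    then obtain d where "m = int N * d" by blast
    then have "z = cis (2 * pi * of_int d)" unfolding z_def using assms by (intro arg_cong[where f=cis]) simp
    then have "z = 1" by (simp only: cis_multiple_2pi Ints_of_int)
    then show ?thesis using True by (simp add: sum)
  next
    case False
    have "z \<noteq> 1"
    proof
      assume "z = 1"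
      then have "cos (2 * pi * m / N) = 1" by (simp add: z_def complex_eq_iff)
      then obtain d :: int where "2 * pi * m / N = of_int d * 2 * pi" using cos_one_2pi_int by blast
      then have "real_of_int m = of_int (int N * d)" using assms by (simp add: field_simps)
      then have "m = int N * d" by linarith
      then show False using False by simp
    qed
    then show ?thesis using False zN by (simp add: sum geometric_sum)
  qed
qed

text \<open>Expanding the squared modulus and summing over \<open>j\<close> first leaves only the
  diagonal terms, by orthogonality of the characters of the cyclic group.\<close>

lemma discrete_parseval:
  fixes a :: "int \<Rightarrow> real" and N :: nat
  assumes "N > 0"
  shows "(\<Sum>j<N. (cmod (\<Sum>m\<in>{0..<int N}. a m * cis (2 * pi * real j * m / N)))\<^sup>2) = N * (\<Sum>m\<in>{0..<int N}. (a m)\<^sup>2)"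
proof -
  let ?I = "{0..<int N}"
  let ?e = "\<lambda>j m. cis (2 * pi * real j * of_int m / N)"
  have "complex_of_real (\<Sum>j<N. (cmod (\<Sum>m\<in>?I. a m * ?e j m))\<^sup>2)
      = (\<Sum>j<N. (\<Sum>m\<in>?I. a m * ?e j m) * cnj (\<Sum>l\<in>?I. a l * ?e j l))"
    unfolding of_real_sum complex_norm_square ..
  also have "\<dots> = (\<Sum>j<N. \<Sum>m\<in>?I. \<Sum>l\<in>?I. a m * a l * ?e j (m - l))"
  proof (intro sum.cong refl)
    fix j
    have "?e j m * cnj (?e j l) = ?e j (m - l)" for m l
      by (simp add: cis_cnj cis_mult right_diff_distrib diff_divide_distrib)
    then have "a m * ?e j m * (a l * cnj (?e j l)) = a m * a l * ?e j (m - l)" for m l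
      by (simp flip: \<open>\<And>m l. ?e j m * cnj (?e j l) = ?e j (m - l)\<close>)
    then show "(\<Sum>m\<in>?I. a m * ?e j m) * cnj (\<Sum>l\<in>?I. a l * ?e j l) = (\<Sum>m\<in>?I. \<Sum>l\<in>?I. a m * a l * ?e j (m - l))"
      by (simp only: cnj_sum sum_product complex_cnj_mult complex_cnj_complex_of_real)
  qed
  also have "\<dots> = (\<Sum>m\<in>?I. \<Sum>l\<in>?I. a m * a l * (\<Sum>j<N. ?e j (m - l)))"
    by (subst sum.swap, intro sum.cong refl, subst sum.swap) (simp add: sum_distrib_left)
  also have "\<dots> = (\<Sum>m\<in>?I. \<Sum>l\<in>?I. if l = m then complex_of_real (a m * a l) * of_nat N else 0)"
  proof (intro sum.cong refl)
    fix m l assume "m \<in> ?I" "l \<in> ?I"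
    \<comment> \<open>Distinct elements of \<open>{0..<int N}\<close> are incongruent modulo
      \<open>N\<close>.\<close>
    then have "int N dvd m - l \<longleftrightarrow> l = m"
      by (auto simp flip: mod_eq_dvd_iff)
    then show "a m * a l * (\<Sum>j<N. ?e j (m - l)) = (if l = m then complex_of_real (a m * a l) * of_nat N else 0)"
      using sum_cis_roots_of_unity[OF assms, of "m - l"] by simp
  qed
  also have "\<dots> = complex_of_real (N * (\<Sum>m\<in>?I. (a m)\<^sup>2))"
    by (simp add: sum_distrib_left power2_eq_square mult_ac)
  finally show ?thesis by (simp only: of_real_eq_iff)
qed

lemma cmod_cis_minus_one: "(cmod (cis x - 1))\<^sup>2 = 2 - 2 * cos x"
proof -
  have "(cmod (cis x - 1))\<^sup>2 = (cos x)\<^sup>2 + (sin x)\<^sup>2 + 1 - 2 * cos x"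
    by (simp add: cmod_power2 power2_diff)
  then show ?thesis by simp
qed

text \<open>
  The measure has mass proportional to \<open>\<bar>P\<bar>\<^sup>2\<close> at the \<open>N\<close>-th roots of unity, where \<open>P\<close> is the
  polynomial with coefficients \<open>f 0, \<dots>, f (N - 1)\<close>; multiplying \<open>P\<close> by \<open>z ^ n\<close> shifts its coefficients
  cyclically.
\<close>
lemma ex_cyclic_spectral_measure:
  fixes f :: "int \<Rightarrow> real" and N :: nat
  assumes "N > 0" and f: "\<And>m. f m > 0"
  shows "\<exists>\<mu>. real_distribution \<mu> \<and> measure \<mu> {-1<..2*pi} = 1 \<and>
    (\<forall>n::int. (\<integral>t. 2 - 2 * cos (n * t) \<partial>\<mu>) =
      (\<Sum>m\<in>{0..<int N}. (f ((m - n) mod N) - f m)\<^sup>2) / (\<Sum>m\<in>{0..<int N}. (f m)\<^sup>2))"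
proof -
  let ?I = "{0..<int N}"
  let ?S = "\<Sum>m\<in>?I. (f m)\<^sup>2"
  have S: "?S > 0" using assms by (intro sum_pos) (auto simp: power2_eq_square)
  define P where "P j = (\<Sum>m\<in>?I. f m * cis (2 * pi * real j * of_int m / N))" for j
  define w where "w j = (cmod (P j))\<^sup>2 / (N * ?S)" for j
  define M where "M = point_measure {..<N} (\<lambda>j. ennreal (w j))"
  define \<mu> where "\<mu> = distr M borel (\<lambda>j. 2 * pi * real j / N)"
  have w: "w j \<ge> 0" for j unfolding w_def using S by simp
  have "(\<Sum>j<N. w j) = 1"
    using discrete_parseval[OF assms(1), of f] S assms(1) by (simp add: w_def P_def flip: sum_divide_distrib)
  then have "emeasure M (space M) = 1"
    using w by (simp add: M_def space_point_measure emeasure_point_measure_finite sum_ennreal)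
  then interpret M: prob_space M by (rule prob_spaceI)
  have meas: "g \<in> borel_measurable M" for g :: "nat \<Rightarrow> real" by (simp add: M_def)
  have real_dist: "real_distribution \<mu>"
    unfolding real_distribution_def real_distribution_axioms_def \<mu>_def
    using M.prob_space_distr[OF meas] by auto
  \<comment> \<open>Tightness is stated with intervals open on the left, so the left end is moved
    below the angle 0.\<close>
  have "measure \<mu> {-1<..2*pi} = measure M (space M)"
    unfolding \<mu>_def
  proof (subst measure_distr[OF meas])
    have "-1 < 2 * pi * real j / N \<and> 2 * pi * real j / N \<le> 2 * pi" if "j < N" for j
    proof
      have "0 \<le> 2 * pi * real j / N" by simp
      then show "-1 < 2 * pi * real j / N" by linarith
      show "2 * pi * real j / N \<le> 2 * pi" using that by (simp add: field_simps)
    qed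
    then show "measure M ((\<lambda>j. 2 * pi * real j / N) -` {-1<..2*pi} \<inter> space M) = measure M (space M)"
      by (intro arg_cong[where f="measure M"]) (auto simp: M_def space_point_measure)
  qed simp
  moreover have "(\<integral>t. 2 - 2 * cos (n * t) \<partial>\<mu>) = (\<Sum>m\<in>?I. (f ((m - n) mod N) - f m)\<^sup>2) / ?S" for n :: int
  proof -
    \<comment> \<open>Parseval applied to these difference coefficients will evaluate the integral,
      since the integrand is \<open>(cmod (cis (n * t) - 1))\<^sup>2\<close>.\<close>
    have shift: "(cis (n * (2 * pi * real j / N)) - 1) * P j
        = (\<Sum>m\<in>?I. complex_of_real (f ((m - n) mod N) - f m) * cis (2 * pi * real j * of_int m / N))" for j
    proof -
      have "cis (n * (2 * pi * real j / N)) * P j = (\<Sum>m\<in>?I. f m * cis (2 * pi * real j * of_int (m + n) / N))"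
        unfolding P_def sum_distrib_left
      proof (intro sum.cong refl)
        fix m
        have "n * (2 * pi * real j / N) + 2 * pi * real j * of_int m / N = 2 * pi * real j * of_int (m + n) / N"
          by (simp add: add_divide_distrib algebra_simps)
        then show "cis (n * (2 * pi * real j / N)) * (f m * cis (2 * pi * real j * of_int m / N))
            = f m * cis (2 * pi * real j * of_int (m + n) / N)"
          by (metis cis_mult mult.left_commute)
      qed
      also have "\<dots> = (\<Sum>m\<in>?I. f ((m - n) mod N) * cis (2 * pi * real j * of_int m / N))"
      proof (rule sum.reindex_bij_witness[of _ "\<lambda>m. (m - n) mod N" "\<lambda>m. (m + n) mod N"])
        fix m assume m: "m \<in> ?I"
        show "((m + n) mod N - n) mod N = m" "((m - n) mod N + n) mod N = m"
          using m by (simp_all add: mod_simps)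
        have "2 * pi * real j * of_int (m + n) / N = 2 * pi * real j * of_int ((m + n) mod N) / N
           + 2 * pi * of_int (int j * ((m + n) div N))"
        proof -
          have "real_of_int (m + n) = of_int (N * ((m + n) div N) + (m + n) mod N)"
            by (simp only: mult_div_mod_eq)
          then have "real_of_int (m + n) = real N * of_int ((m + n) div N) + of_int ((m + n) mod N)"
            by (simp only: of_int_add of_int_mult of_int_of_nat_eq)
          then show ?thesis using assms(1) by (simp only:) (simp add: field_simps)
        qed
        moreover have "cis (x + 2 * pi * of_int i) = cis x" for x and i :: int
          by (simp flip: cis_mult)
        ultimately have "cis (2 * pi * real j * of_int (m + n) / N) = cis (2 * pi * real j * of_int ((m + n) mod N) / N)"
          by (simp only:)
        then show "complex_of_real (f (((m + n) mod N - n) mod N)) * cis (2 * pi * real j * of_int ((m + n) mod N) / N)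
          = f m * cis (2 * pi * real j * of_int (m + n) / N)"
          using m by (simp add: mod_simps)
      qed (use assms(1) in auto)
      finally show ?thesis
        by (simp add: left_diff_distrib sum_subtractf P_def)
    qed
    have "(\<integral>t. 2 - 2 * cos (n * t) \<partial>\<mu>) = (\<Sum>j<N. w j * (2 - 2 * cos (n * (2 * pi * real j / N))))"
      unfolding \<mu>_def by (subst integral_distr[OF meas]) (simp_all add: M_def lebesgue_integral_point_measure_finite w)
    also have "\<dots> = (\<Sum>j<N. (cmod ((cis (n * (2 * pi * real j / N)) - 1) * P j))\<^sup>2) / (N * ?S)"
      unfolding sum_divide_distrib
      by (intro sum.cong refl) (simp add: w_def norm_mult power_mult_distrib cmod_cis_minus_one mult.commute)
    also have "\<dots> = (\<Sum>m\<in>?I. (f ((m - n) mod N) - f m)\<^sup>2) / ?S"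
      unfolding shift by (subst discrete_parseval[OF assms(1)]) (use assms(1) in simp)
    finally show ?thesis .
  qed
  ultimately show ?thesis using real_dist M.prob_space by metis
qed

text \<open>A weak limit of the cyclic measures for growing \<open>N\<close>. They all live on one
  bounded interval, hence are tight, and \<open>2 - 2 * cos (n * t)\<close> is a bounded continuous
  test function. The window length is \<open>Suc (r i)\<close> so that it is never zero.\<close>

lemma ex_spectral_measure:
  fixes f :: "int \<Rightarrow> real"
  assumes f: "\<And>m. f m > 0"
  obtains \<mu> and r :: "nat \<Rightarrow> nat" where "real_distribution \<mu>" "strict_mono r"
    "\<And>n::int. (\<lambda>i. (\<Sum>m\<in>{0..<int (Suc (r i))}. (f ((m - n) mod Suc (r i)) - f m)\<^sup>2) / (\<Sum>m\<in>{0..<int (Suc (r i))}. (f m)\<^sup>2))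
       \<longlonglongrightarrow> (\<integral>t. 2 - 2 * cos (n * t) \<partial>\<mu>)"
proof -
  have "\<forall>N. \<exists>\<mu>. real_distribution \<mu> \<and> measure \<mu> {-1<..2*pi} = 1 \<and>
    (\<forall>n::int. (\<integral>t. 2 - 2 * cos (n * t) \<partial>\<mu>) =
      (\<Sum>m\<in>{0..<int (Suc N)}. (f ((m - n) mod Suc N) - f m)\<^sup>2) / (\<Sum>m\<in>{0..<int (Suc N)}. (f m)\<^sup>2))"
    by (intro allI ex_cyclic_spectral_measure f) simp
  from choice[OF this] obtain \<nu> where \<nu>: "\<And>N. real_distribution (\<nu> N)" "\<And>N. measure (\<nu> N) {-1<..2*pi} = 1"
    "\<And>N n. (\<integral>t. 2 - 2 * cos (of_int n * t) \<partial>\<nu> N) =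
      (\<Sum>m\<in>{0..<int (Suc N)}. (f ((m - n) mod Suc N) - f m)\<^sup>2) / (\<Sum>m\<in>{0..<int (Suc N)}. (f m)\<^sup>2)"
    by blast
  have "(-1::real) < 2 * pi" using pi_gt_zero by linarith
  then have "tight \<nu>" unfolding tight_def
    using \<nu>(1,2) by (intro conjI allI impI exI[of _ "-1"] exI[of _ "2*pi"]) auto
  then obtain r \<mu> where r: "strict_mono r" "real_distribution \<mu>" "weak_conv_m (\<nu> \<circ> id \<circ> r) \<mu>"
    using tight_imp_convergent_subsubsequence[OF _ strict_mono_id] by blast
  show thesis
  proof (rule that[OF r(2,1)])
    fix n :: int
    have "(\<lambda>i. \<integral>t. 2 - 2 * cos (n * t) \<partial>(\<nu> \<circ> id \<circ> r) i) \<longlonglongrightarrow> (\<integral>t. 2 - 2 * cos (n * t) \<partial>\<mu>)"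
    proof (rule weak_conv_imp_integral_bdd_continuous_conv[OF _ r(2,3)])
      show "norm (2 - 2 * cos (n * t)) \<le> 4" for t :: real
        using cos_ge_minus_one[of "n * t"] cos_le_one[of "n * t"] by (simp only: real_norm_def abs_le_iff) linarith
    qed (use \<nu>(1) in \<open>auto intro!: continuous_intros\<close>)
    then show "(\<lambda>i. (\<Sum>m\<in>{0..<int (Suc (r i))}. (f ((m - n) mod Suc (r i)) - f m)\<^sup>2) / (\<Sum>m\<in>{0..<int (Suc (r i))}. (f m)\<^sup>2))
       \<longlonglongrightarrow> (\<integral>t. 2 - 2 * cos (n * t) \<partial>\<mu>)"
      by (simp only: comp_apply id_apply \<nu>(3))
  qed
qed

section \<open>Discrete group of angles\<close>

text \<open>As long as \<open>m - n\<close> does not leave the window, the Lipschitz property of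
  \<open>p\<close> bounds the difference by \<open>p n\<close>; at most \<open>\<bar>n\<bar>\<close>
  indices wrap around, and each costs at most 1 because \<open>p\<close> takes values between 0 and
  1.\<close>

lemma sum_cyclic_shift_le:
  fixes p :: "int \<Rightarrow> real" and n :: int and N :: nat
  assumes p: "\<And>x. 0 \<le> p x" "\<And>x. p x \<le> 1" "\<And>x y. \<bar>p (x + y) - p x\<bar> \<le> p y"
  shows "(\<Sum>m\<in>{0..<int N}. (p ((m - n) mod N) - p m)\<^sup>2) \<le> N * (p n)\<^sup>2 + \<bar>n\<bar>"
proof -
  let ?I = "{0..<int N}"
  let ?B = "{m \<in> ?I. m - n \<notin> ?I}"
  have "(\<Sum>m\<in>?I. (p ((m - n) mod N) - p m)\<^sup>2) \<le> (\<Sum>m\<in>?I. (p n)\<^sup>2 + (if m - n \<notin> ?I then 1 else 0))"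
  proof (rule sum_mono)
    fix m assume "m \<in> ?I"
    show "(p ((m - n) mod N) - p m)\<^sup>2 \<le> (p n)\<^sup>2 + (if m - n \<notin> ?I then 1 else 0)"
    proof (cases "m - n \<in> ?I")
      case True
      have "\<bar>p (m - n) - p m\<bar> \<le> p n" using p(3)[of "m - n" n] by (simp add: abs_minus_commute)
      then have "(p (m - n) - p m)\<^sup>2 \<le> (p n)\<^sup>2" by (rule abs_le_square_iff[THEN iffD1, OF order_trans]) simp
      then show ?thesis using True by simp
    next
      case False
      have "\<bar>p ((m - n) mod N) - p m\<bar> \<le> 1"
        using p(1)[of m] p(2)[of m] p(1)[of "(m - n) mod N"] p(2)[of "(m - n) mod N"] by linarith
      then have "(p ((m - n) mod N) - p m)\<^sup>2 \<le> 1" by (simp add: abs_square_le_1)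
      then show ?thesis using False by (smt (verit) zero_le_power2)
    qed
  qed
  also have "\<dots> = N * (p n)\<^sup>2 + card ?B"
    by (simp add: sum.distrib sum.If_cases Int_def)
  \<comment> \<open>Depending on the sign of \<open>n\<close>, at most one of the two intervals is
    nonempty.\<close>
  also have "card ?B \<le> card ({0..<n} \<union> {N + n..<N})"
    by (rule card_mono) auto
  also have "card ({0..<n} \<union> {N + n..<N}) \<le> nat \<bar>n\<bar>"
    by (rule order_trans[OF card_Un_le]) auto
  finally show ?thesis by simp
qed

text \<open>Here precompactness enters: finitely many translates of \<open>V\<close> cover the
  integers, so \<open>V\<close> fills a proportion of at least about \<open>1 / card F\<close> of a
  long window. At each \<open>v\<close> in \<open>V\<close> the value of \<open>p\<close> is below
  \<open>1 / 8\<close>, whereas at \<open>v + q\<close> it exceeds \<open>3 / 8\<close>, so the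
  square at \<open>m = v + q\<close> is at least \<open>1 / 16\<close>.\<close>

lemma sum_cyclic_shift_ge:
  fixes p :: "int \<Rightarrow> real" and q M :: int and N :: nat
  assumes p: "\<And>x y. \<bar>p (x + y) - p x\<bar> \<le> p y" and q: "q > 0" "p q \<ge> 1 / 2"
    and V: "\<And>x. x \<in> V \<Longrightarrow> p x < 1 / 8" and F: "finite F" "{v + x | v x. v \<in> V \<and> x \<in> F} = UNIV"
    and M: "\<And>x. x \<in> F \<Longrightarrow> \<bar>x\<bar> \<le> M"
  shows "(N - q - 2 * M) / (16 * card F) \<le> (\<Sum>m\<in>{0..<int N}. (p ((m - q) mod N) - p m)\<^sup>2)"
proof -
  define A where "A = {v \<in> {0..<N - q}. v \<in> V}"
  have fin: "finite A" unfolding A_def by (rule finite_subset[OF _ finite_atLeastLessThan_int]) blast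
  \<comment> \<open>Points this far from both ends keep their \<open>V\<close>-part inside
    \<open>{0..<N - q}\<close>.\<close>
  have "{M..<N - q - M} \<subseteq> (\<lambda>(v, x). v + x) ` (A \<times> F)"
  proof
    fix y assume y: "y \<in> {M..<N - q - M}"
    obtain v x where "y = v + x" "v \<in> V" "x \<in> F" using F(2) by blast
    moreover from this y M[of x] have "v \<in> {0..<N - q}" by auto
    ultimately show "y \<in> (\<lambda>(v, x). v + x) ` (A \<times> F)" by (auto simp: A_def)
  qed
  then have "card {M..<N - q - M} \<le> card (A \<times> F)"
    by (rule surj_card_le[rotated]) (use fin F in simp)
  then have card: "N - q - 2 * M \<le> card A * card F" by (simp add: card_cartesian_product nat_le_iff)
  have "F \<noteq> {}" using F(2) by auto
  then have "card F > 0" using F(1) by (simp add: card_gt_0_iff)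
  moreover have "real_of_int (N - q - 2 * M) \<le> real (card A * card F)" using card by linarith
  ultimately have "(N - q - 2 * M) / (16 * card F) \<le> (\<Sum>v\<in>A. 1 / 16)"
    by (simp add: field_simps)
  also have "\<dots> \<le> (\<Sum>v\<in>A. (p v - p (v + q))\<^sup>2)"
  proof (rule sum_mono)
    fix v assume "v \<in> A"
    then have "p v < 1 / 8" using V[of v] by (simp add: A_def)
    then have "1 / 4 \<le> \<bar>p v - p (v + q)\<bar>" using p[of q v] q(2) by (simp add: add.commute)
    then have "(1 / 4)\<^sup>2 \<le> (p v - p (v + q))\<^sup>2" by (subst power2_abs[symmetric]) (rule power_mono, auto)
    then show "1 / 16 \<le> (p v - p (v + q))\<^sup>2" by (simp add: power2_eq_square)
  qed
  \<comment> \<open>Shifting \<open>m = v + q\<close> back by \<open>q\<close> gives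
    \<open>v\<close>, which lies in the window, so \<open>mod\<close> has no effect.\<close>
  also have "\<dots> = (\<Sum>m\<in>(\<lambda>v. v + q) ` A. (p ((m - q) mod N) - p m)\<^sup>2)"
    by (subst sum.reindex) (use q(1) in \<open>auto simp: A_def intro!: sum.cong\<close>)
  also have "\<dots> \<le> (\<Sum>m\<in>{0..<int N}. (p ((m - q) mod N) - p m)\<^sup>2)"
    by (rule sum_mono2) (use q(1) in \<open>auto simp: A_def\<close>)
  finally show ?thesis .
qed

text \<open>The distance of \<open>cis x\<close> from 1 is
  \<open>sqrt (2 - 2 * cos x)\<close>.\<close>

lemma cis_tendsto_1_iff_cos:
  "((\<lambda>k. cis (x k)) \<longlongrightarrow> 1) F \<longleftrightarrow> ((\<lambda>k. cos (x k)) \<longlongrightarrow> 1) F"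
proof
  assume "((\<lambda>k. cos (x k)) \<longlongrightarrow> 1) F"
  then have "((\<lambda>k. sqrt (2 - 2 * cos (x k))) \<longlongrightarrow> sqrt (2 - 2 * 1)) F" by (intro tendsto_intros)
  moreover have "sqrt (2 - 2 * cos (x k)) = cmod (cis (x k) - 1)" for k
    by (simp flip: cmod_cis_minus_one)
  ultimately have "((\<lambda>k. cmod (cis (x k) - 1)) \<longlongrightarrow> 0) F" by simp
  then show "((\<lambda>k. cis (x k)) \<longlongrightarrow> 1) F" by (simp add: tendsto_norm_zero_iff LIM_zero_iff)
qed (use tendsto_Re in fastforce)

text \<open>The spectral measure of \<open>1 + p\<close> can have atoms only at angles along which
  \<open>cis (n k * t)\<close> tends to 1, and these are annihilated by \<open>q\<close>. Since
  \<open>p q \<ge> 1 / 2\<close>, some of its mass lies at angles that \<open>q\<close> does not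
  annihilate, and there it is continuous.\<close>

lemma rigidity_sequence_if_annihilated:
  fixes n :: "nat \<Rightarrow> int" and q :: int
  assumes \<tau>: "precompact_group_topology \<tau>" "limitin \<tau> n 0 sequentially" and q: "q > 0"
    and annihilated: "\<And>t::real. (\<lambda>k. cis (n k * t)) \<longlonglongrightarrow> 1 \<Longrightarrow> cis (q * t) = 1"
  shows "rigidity_sequence n"
proof -
  have gt: "group_topology \<tau>" and haus: "Hausdorff_space \<tau>"
    and precompact: "\<And>U. openin \<tau> U \<Longrightarrow> U \<noteq> {} \<Longrightarrow> \<exists>F. finite F \<and> {u + x |u x. u \<in> U \<and> x \<in> F} = UNIV"
    using \<tau>(1) by (auto simp: precompact_group_topology_def)
  obtain p :: "int \<Rightarrow> real" where p: "\<And>x. 0 \<le> p x" "\<And>x. p x \<le> 1" "\<And>x y. \<bar>p (x + y) - p x\<bar> \<le> p y"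
    and pq: "p q \<ge> 1 / 2" and small: "\<And>e. e > 0 \<Longrightarrow> \<exists>V. openin \<tau> V \<and> 0 \<in> V \<and> (\<forall>x\<in>V. p x < e)"
    using group_topology_pseudonorm[OF gt haus, of q] q by (metis less_irrefl)
  \<comment> \<open>Adding 1 keeps the normalising sum of squares between \<open>N\<close> and
    \<open>4 * N\<close> and leaves all differences of \<open>p\<close> unchanged.\<close>
  define f where "f x = 1 + p x" for x
  have f_pos: "f x > 0" for x using p(1)[of x] by (simp add: f_def)
  have f_bounds: "1 \<le> (f x)\<^sup>2" "(f x)\<^sup>2 \<le> 4" for x
    using power_mono[of 1 "f x" 2] power_mono[of "f x" 2 2] p(1)[of x] p(2)[of x] by (auto simp: f_def)
  have S_bounds: "N \<le> (\<Sum>m\<in>{0..<int N}. (f m)\<^sup>2)" "(\<Sum>m\<in>{0..<int N}. (f m)\<^sup>2) \<le> 4 * N" for N :: nat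
    using sum_mono[of "{0..<int N}" "\<lambda>_. 1" "\<lambda>m. (f m)\<^sup>2"] sum_mono[of "{0..<int N}" "\<lambda>m. (f m)\<^sup>2" "\<lambda>_. 4"] f_bounds
    by auto
  obtain \<mu> and r :: "nat \<Rightarrow> nat" where \<mu>: "real_distribution \<mu>" and r: "strict_mono r"
    and lim: "\<And>n::int. (\<lambda>i. (\<Sum>m\<in>{0..<int (Suc (r i))}. (f ((m - n) mod Suc (r i)) - f m)\<^sup>2) / (\<Sum>m\<in>{0..<int (Suc (r i))}. (f m)\<^sup>2))
       \<longlonglongrightarrow> (\<integral>t. 2 - 2 * cos (n * t) \<partial>\<mu>)"
    by (rule ex_spectral_measure[of f, OF f_pos]) blast
  have f_diff: "f x - f y = p x - p y" for x y by (simp add: f_def)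
  have subseq: "(\<lambda>i. c / real (Suc (r i))) \<longlonglongrightarrow> 0" for c
    using LIMSEQ_subseq_LIMSEQ[OF LIMSEQ_Suc[OF lim_const_over_n[of c]] r] by (simp add: comp_def)
  \<comment> \<open>After normalisation the wrap-around error is at most
    \<open>\<bar>j\<bar> / N\<close>, which vanishes in the limit.\<close>
  have upper: "(\<integral>t. 2 - 2 * cos (j * t) \<partial>\<mu>) \<le> (p j)\<^sup>2" for j :: int
  proof (rule LIMSEQ_le[OF lim])
    show "(\<lambda>i. (p j)\<^sup>2 + \<bar>j\<bar> / real (Suc (r i))) \<longlonglongrightarrow> (p j)\<^sup>2"
      using tendsto_add[OF tendsto_const subseq, of "(p j)\<^sup>2"] by simp
    have "(\<Sum>m\<in>{0..<int N}. (f ((m - j) mod N) - f m)\<^sup>2) / (\<Sum>m\<in>{0..<int N}. (f m)\<^sup>2) \<le> (p j)\<^sup>2 + \<bar>j\<bar> / N" if "N > 0" for N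
    proof -
      have "(\<Sum>m\<in>{0..<int N}. (f ((m - j) mod N) - f m)\<^sup>2) / (\<Sum>m\<in>{0..<int N}. (f m)\<^sup>2) \<le> (N * (p j)\<^sup>2 + \<bar>j\<bar>) / N"
        unfolding f_diff by (intro frac_le sum_cyclic_shift_le p S_bounds) (use that in auto)
      then show ?thesis using that by (simp add: add_divide_distrib)
    qed
    then show "\<exists>N. \<forall>i\<ge>N. (\<Sum>m\<in>{0..<int (Suc (r i))}. (f ((m - j) mod Suc (r i)) - f m)\<^sup>2) / (\<Sum>m\<in>{0..<int (Suc (r i))}. (f m)\<^sup>2)
       \<le> (p j)\<^sup>2 + \<bar>j\<bar> / real (Suc (r i))" by blast
  qed
  have lower: "(\<integral>t. 2 - 2 * cos (q * t) \<partial>\<mu>) > 0"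
  proof -
    obtain V where V: "openin \<tau> V" "0 \<in> V" "\<And>x. x \<in> V \<Longrightarrow> p x < 1 / 8" using small[of "1/8"] by auto
    obtain F where F: "finite F" "{v + x |v x. v \<in> V \<and> x \<in> F} = UNIV" using precompact[OF V(1)] V(2) by auto
    define M where "M = Max (abs ` F)"
    have M: "\<bar>x\<bar> \<le> M" if "x \<in> F" for x using F(1) that by (simp add: M_def)
    \<comment> \<open>The factor 64 combines the \<open>1 / 16\<close> per point of \<open>V\<close>
      with the bound \<open>4 * N\<close> on the normalising sum.\<close>
    define c where "c = 1 / (64 * real (card F))"
    have "F \<noteq> {}" using F(2) by auto
    then have c: "c > 0" using F(1) by (simp add: c_def card_gt_0_iff)
    have "c \<le> (\<integral>t. 2 - 2 * cos (q * t) \<partial>\<mu>)"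
    proof (rule LIMSEQ_le[OF _ lim])
      show "(\<lambda>i. c - c * (q + 2 * M) / real (Suc (r i))) \<longlonglongrightarrow> c"
        using tendsto_diff[OF tendsto_const subseq, of c] by simp
      have "c - c * (q + 2 * M) / N \<le> (\<Sum>m\<in>{0..<int N}. (f ((m - q) mod N) - f m)\<^sup>2) / (\<Sum>m\<in>{0..<int N}. (f m)\<^sup>2)" if "N > 0" for N :: nat
      proof (cases "N - q - 2 * M \<ge> 0")
        case True
        have "c - c * (q + 2 * M) / N = ((N - q - 2 * M) / (16 * card F)) / (4 * N)"
        proof -
          have "c - c * (q + 2 * M) / N = c * (N - q - 2 * M) / N" using that by (simp add: right_diff_distrib diff_divide_distrib distrib_left add_divide_distrib)
          then show ?thesis by (simp add: c_def)
        qed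
        also have "\<dots> \<le> (\<Sum>m\<in>{0..<int N}. (f ((m - q) mod N) - f m)\<^sup>2) / (\<Sum>m\<in>{0..<int N}. (f m)\<^sup>2)"
          unfolding f_diff
        proof (intro frac_le sum_cyclic_shift_ge[OF p(3) q pq V(3) F M] S_bounds)
          show "0 < (\<Sum>m\<in>{0..<int N}. (f m)\<^sup>2)" using S_bounds(1)[of N] that by linarith
        qed (auto intro: sum_nonneg)
        finally show ?thesis .
      next
        case False
        then have "real N \<le> q + 2 * M" by linarith
        then have "c * N \<le> c * (q + 2 * M)" using c by (simp add: mult_left_mono)
        then have "c - c * (q + 2 * M) / N \<le> 0" using that by (simp add: field_simps)
        also have "0 \<le> (\<Sum>m\<in>{0..<int N}. (f ((m - q) mod N) - f m)\<^sup>2) / (\<Sum>m\<in>{0..<int N}. (f m)\<^sup>2)"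
          by (intro divide_nonneg_nonneg sum_nonneg) auto
        finally show ?thesis .
      qed
      then show "\<exists>N. \<forall>i\<ge>N. c - c * (q + 2 * M) / real (Suc (r i)) \<le> (\<Sum>m\<in>{0..<int (Suc (r i))}. (f ((m - q) mod Suc (r i)) - f m)\<^sup>2) / (\<Sum>m\<in>{0..<int (Suc (r i))}. (f m)\<^sup>2)"
        by blast
    qed
    with c show ?thesis by linarith
  qed

  interpret \<mu>: real_distribution \<mu> by fact
  have pn: "(\<lambda>k. p (n k)) \<longlonglongrightarrow> 0"
  proof (rule order_tendstoI)
    fix e :: real assume "0 < e"
    then obtain V where "openin \<tau> V" "0 \<in> V" "\<forall>x\<in>V. p x < e" using small by blast
    then show "\<forall>\<^sub>F k in sequentially. p (n k) < e" using \<tau>(2) unfolding limitin_def by (smt (verit) eventually_mono)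
  next
    fix e :: real assume "e < 0"
    then show "\<forall>\<^sub>F k in sequentially. e < p (n k)" using p(1) by (intro always_eventually) (metis less_le_trans)
  qed
  have [measurable]: "(\<lambda>t. cis (c * t)) \<in> borel_measurable borel" for c
    by (intro borel_measurable_continuous_onI continuous_intros)
  have int: "integrable \<mu> (\<lambda>t. 1 - cos (j * t))" for j :: int
    by (rule \<mu>.integrable_const_bound[where B=2]) (auto simp: abs_le_iff intro: order_trans[OF _ cos_ge_minus_one] order_trans[OF cos_le_one])
  have lim0: "(\<lambda>k. \<integral>t. 1 - cos (n k * t) \<partial>\<mu>) \<longlonglongrightarrow> 0"
  proof (rule tendsto_sandwich[OF _ _ tendsto_const])
    show "\<forall>\<^sub>F k in sequentially. 0 \<le> (\<integral>t. 1 - cos (n k * t) \<partial>\<mu>)" by (intro always_eventually allI integral_nonneg) simp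
    have two: "2 * (\<integral>t. 1 - cos (j * t) \<partial>\<mu>) = (\<integral>t. 2 - 2 * cos (j * t) \<partial>\<mu>)" for j :: int
      by (subst integral_mult_right_zero[symmetric]) (simp add: algebra_simps)
    have "(\<integral>t. 1 - cos (j * t) \<partial>\<mu>) \<le> (p j)\<^sup>2" for j :: int
      using upper[of j] two[of j] zero_le_power2[of "p j"] by linarith
    then show "\<forall>\<^sub>F k in sequentially. (\<integral>t. 1 - cos (n k * t) \<partial>\<mu>) \<le> (p (n k))\<^sup>2" by simp
    show "(\<lambda>k. (p (n k))\<^sup>2) \<longlonglongrightarrow> 0" using tendsto_power[OF pn, of 2] by simp
  qed

  \<comment> \<open>Restricting to \<open>E\<close> removes every atom; its mass is positive by
    \<open>lower\<close>, since \<open>2 - 2 * cos (q * t)\<close> vanishes off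
    \<open>E\<close>.\<close>
  define E where "E = {t::real. cis (q * t) \<noteq> 1}"
  have E [measurable]: "E \<in> sets borel" unfolding E_def by measurable
  have E_pos: "measure \<mu> E > 0"
  proof (rule ccontr)
    assume "\<not> 0 < measure \<mu> E"
    then have "measure \<mu> E = 0" by (simp add: zero_less_measure_iff)
    then have "AE t in \<mu>. t \<notin> E" by (simp add: \<mu>.prob_eq_0)
    then have "AE t in \<mu>. 2 - 2 * cos (q * t) = 0" by eventually_elim (auto simp: E_def complex_eq_iff)
    then have "(\<integral>t. 2 - 2 * cos (q * t) \<partial>\<mu>) = (\<integral>t. 0 \<partial>\<mu>)" by (intro integral_cong_AE) auto
    with lower show False by simp
  qed
  define \<nu> where "\<nu> = uniform_measure \<mu> E"
  \<comment> \<open>The density is at most \<open>1 / measure \<mu> E\<close>, so integrals of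
    nonnegative functions against \<open>\<nu>\<close> are controlled by those against
    \<open>\<mu>\<close>.\<close>
  have \<nu>_eq: "\<nu> = density \<mu> (\<lambda>t. ennreal (indicator E t / measure \<mu> E))"
    unfolding \<nu>_def uniform_measure_def \<mu>.emeasure_eq_measure
    by (intro density_cong) (auto simp: indicator_def divide_ennreal[symmetric] E_pos)
  have sets_\<nu> [measurable_cong]: "sets \<nu> = sets borel" by (simp add: \<nu>_def)
  show ?thesis
  proof (rule rigidity_sequenceI)
    show "prob_space \<nu>" unfolding \<nu>_def
      using E_pos by (intro prob_space_uniform_measure) (auto simp: \<mu>.emeasure_eq_measure)
    show "(\<lambda>t. t) \<in> borel_measurable \<nu>" by measurable
    show "(\<lambda>k. \<integral>t. 1 - cos (n k * t) \<partial>\<nu>) \<longlonglongrightarrow> 0"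
    proof (rule tendsto_sandwich[OF _ _ tendsto_const])
      show "\<forall>\<^sub>F k in sequentially. 0 \<le> (\<integral>t. 1 - cos (n k * t) \<partial>\<nu>)" by (intro always_eventually allI integral_nonneg) simp
      have "(\<integral>t. 1 - cos (j * t) \<partial>\<nu>) \<le> (\<integral>t. 1 - cos (j * t) \<partial>\<mu>) / measure \<mu> E" for j :: int
      proof -
        have "(\<integral>t. 1 - cos (j * t) \<partial>\<nu>) = (\<integral>t. indicator E t / measure \<mu> E * (1 - cos (j * t)) \<partial>\<mu>)"
          unfolding \<nu>_eq using E_pos by (subst integral_density) auto
        also have "\<dots> \<le> (\<integral>t. (1 - cos (j * t)) / measure \<mu> E \<partial>\<mu>)"
        proof (rule integral_mono)
          show "integrable \<mu> (\<lambda>t. indicator E t / measure \<mu> E * (1 - cos (j * t)))"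
            by (rule Bochner_Integration.integrable_bound[OF integrable_divide[OF int[of j], of "measure \<mu> E"]])
               (auto simp: indicator_def)
        qed (use int E_pos in \<open>auto simp: indicator_def\<close>)
        finally show ?thesis by simp
      qed
      then show "\<forall>\<^sub>F k in sequentially. (\<integral>t. 1 - cos (n k * t) \<partial>\<nu>) \<le> (\<integral>t. 1 - cos (n k * t) \<partial>\<mu>) / measure \<mu> E" by simp
      show "(\<lambda>k. (\<integral>t. 1 - cos (n k * t) \<partial>\<mu>) / measure \<mu> E) \<longlonglongrightarrow> 0" using tendsto_divide[OF lim0 tendsto_const] E_pos by fastforce
    qed
    fix z
    define B where "B = {t. cis t = z}"
    have B [measurable]: "B \<in> sets borel" using \<open>\<And>c. (\<lambda>t. cis (c * t)) \<in> borel_measurable borel\<close>[of 1] unfolding B_def by simp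
    \<comment> \<open>If a fibre \<open>B\<close> of \<open>cis\<close> met \<open>E\<close> in
      positive mass, a point \<open>s\<close> of the intersection would satisfy
      \<open>cis (n k * s) \<longlonglongrightarrow> 1\<close>, which \<open>annihilated\<close>
      excludes on \<open>E\<close>.\<close>
    have "measure \<mu> (E \<inter> B) = 0"
    proof (rule ccontr)
      assume ne: "measure \<mu> (E \<inter> B) \<noteq> 0"
      then obtain s where s: "s \<in> E" "s \<in> B" by (metis Int_iff all_not_in_conv measure_empty)
      have B_pos: "measure \<mu> B > 0"
        using ne \<mu>.finite_measure_mono[of "E \<inter> B" B] by (simp add: zero_less_measure_iff) (smt (verit) measure_nonneg)
      have le: "1 - cos (j * s) \<le> (\<integral>t. 1 - cos (j * t) \<partial>\<mu>) / measure \<mu> B" for j :: int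
      proof -
        \<comment> \<open>For integer \<open>j\<close> the value \<open>cis (j * t)\<close> is a
          power of \<open>cis t\<close>, hence constant on \<open>B\<close>.\<close>
        have const: "cos (j * t) = cos (j * s)" if "t \<in> B" for t :: real
        proof -
          have "cis t powi j = cis s powi j" using that s(2) by (simp add: B_def)
          then show ?thesis by (simp add: cis_power_int complex_eq_iff)
        qed
        have "(1 - cos (j * s)) * measure \<mu> B = (\<integral>t. indicator B t * (1 - cos (j * s)) \<partial>\<mu>)" by simp
        also have "\<dots> \<le> (\<integral>t. 1 - cos (j * t) \<partial>\<mu>)"
        proof (rule integral_mono[OF _ int])
          have "integrable \<mu> (indicator B :: real \<Rightarrow> real)"
            by (rule integrable_real_indicator) (auto simp: \<mu>.emeasure_eq_measure)
          then show "integrable \<mu> (\<lambda>t. indicator B t * (1 - cos (j * s)))" by simp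
          show "indicat_real B t * (1 - cos (j * s)) \<le> 1 - cos (j * t)" for t :: real
            by (cases "t \<in> B") (use const[of t] in auto)
        qed
        finally show ?thesis using B_pos by (simp add: field_simps)
      qed
      have "(\<lambda>k. 1 - cos (n k * s)) \<longlonglongrightarrow> 0"
      proof (rule tendsto_sandwich[OF _ _ tendsto_const])
        show "(\<lambda>k. (\<integral>t. 1 - cos (n k * t) \<partial>\<mu>) / measure \<mu> B) \<longlonglongrightarrow> 0" using tendsto_divide[OF lim0 tendsto_const] B_pos by fastforce
      qed (use le in auto)
      then have "(\<lambda>k. 1 - (1 - cos (n k * s))) \<longlonglongrightarrow> 1 - 0" by (intro tendsto_intros)
      then have "(\<lambda>k. cis (n k * s)) \<longlonglongrightarrow> 1" by (simp add: cis_tendsto_1_iff_cos)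
      from annihilated[OF this] s(1) show False by (simp add: E_def)
    qed
    then show "measure \<nu> {t \<in> space \<nu>. cis t = z} = 0"
      unfolding \<nu>_def using E_pos B by (subst measure_uniform_measure) (auto simp: \<mu>.emeasure_eq_measure B_def)
  qed
qed

text \<open>By Dirichlet approximation, a multiple \<open>j * t\<close> with
  \<open>1 \<le> j \<le> N\<close> comes within \<open>2 * pi / N\<close> of a full number of turns.
  The remainder \<open>s\<close> has the same convergence property and is smaller than
  \<open>\<delta>\<close>, so it is zero. As \<open>j\<close> depends on \<open>t\<close>,
  \<open>fact N\<close> serves as a common multiple.\<close>

lemma annihilator_if_no_small_angles:
  fixes n :: "nat \<Rightarrow> int"
  assumes "\<delta> > 0" and gap: "\<And>t::real. 0 < t \<Longrightarrow> t < \<delta> \<Longrightarrow> \<not> (\<lambda>k. cis (n k * t)) \<longlonglongrightarrow> 1"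
  obtains q :: int where "q > 0" "\<And>t::real. (\<lambda>k. cis (n k * t)) \<longlonglongrightarrow> 1 \<Longrightarrow> cis (q * t) = 1"
proof -
  obtain N :: nat where N: "2 * pi / \<delta> < N" using reals_Archimedean2 by blast
  have "0 < 2 * pi / \<delta>" using assms(1) by simp
  with N have "N > 0" by simp
  show thesis
  proof (rule that[of "fact N"])
    fix t :: real assume t: "(\<lambda>k. cis (n k * t)) \<longlonglongrightarrow> 1"
    obtain h j where j: "0 < j" "j \<le> int N" "\<bar>of_int j * (t / (2 * pi)) - of_int h\<bar> < 1 / N"
      using Dirichlet_approx[OF \<open>N > 0\<close>] by metis
    define s where "s = of_int j * t - 2 * pi * of_int h"
    have "\<bar>s\<bar> = 2 * pi * \<bar>of_int j * (t / (2 * pi)) - of_int h\<bar>"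
    proof -
      have "s = 2 * pi * (of_int j * (t / (2 * pi)) - of_int h)" by (simp add: s_def field_simps)
      then show ?thesis by (simp only: abs_mult) simp
    qed
    also have "\<dots> < 2 * pi * (1 / N)" using j(3) by (intro mult_strict_left_mono) auto
    also have "\<dots> < \<delta>" using N \<open>N > 0\<close> assms(1) by (simp add: field_simps)
    finally have s_small: "\<bar>s\<bar> < \<delta>" .
    have "cis (n k * s) = cis (n k * t) powi j" for k
    proof -
      have "n k * s = j * (n k * t) + 2 * pi * of_int (- n k * h)" by (simp add: s_def algebra_simps)
      then have "cis (n k * s) = cis (j * (n k * t)) * cis (2 * pi * of_int (- n k * h))" by (simp only: cis_mult)
      also have "cis (2 * pi * of_int (- n k * h)) = 1" by (rule cis_multiple_2pi) (rule Ints_of_int)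
      finally show ?thesis by (simp add: cis_power_int)
    qed
    moreover have "(\<lambda>k. cis (n k * t) powi j) \<longlonglongrightarrow> 1 powi j" by (intro tendsto_power_int t) simp
    ultimately have s: "(\<lambda>k. cis (n k * s)) \<longlonglongrightarrow> 1" by simp
    \<comment> \<open>\<open>gap\<close> speaks of positive angles only; conjugation handles a
      negative \<open>s\<close>.\<close>
    have "(\<lambda>k. cis (n k * \<bar>s\<bar>)) \<longlonglongrightarrow> 1"
    proof (cases "s \<ge> 0")
      case False
      then show ?thesis using tendsto_cnj[OF s] by (simp add: cis_cnj)
    qed (use s in simp)
    with gap[of "\<bar>s\<bar>"] s_small have "s = 0" by auto
    have "j dvd fact N"
    proof -
      have "nat j dvd fact N" using j(1,2) by (intro dvd_fact) auto
      then have "int (nat j) dvd int (fact N)" by (simp only: int_dvd_int_iff)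
      then show ?thesis using j(1) by simp
    qed
    then obtain e where e: "fact N = j * e" by blast
    have "of_int (fact N) * t = of_int e * (of_int j * t)" unfolding e by simp
    also have "\<dots> = 2 * pi * of_int (h * e)" using \<open>s = 0\<close> by (simp add: s_def)
    finally have "of_int (fact N) * t = 2 * pi * of_int (h * e)" .
    then show "cis (of_int (fact N) * t) = 1" by (simp only: cis_multiple_2pi Ints_of_int)
  qed simp
qed

section \<open>Small angles\<close>

text \<open>The sets are all grid intervals of mesh \<open>1 / Suc j\<close>, enumerated over all
  pairs \<open>(j, l)\<close>. A mesh finer than \<open>y - x\<close> separates the two points, and
  for each \<open>j\<close> only the finitely many \<open>l \<le> j\<close> meet
  \<open>{0..<1}\<close>, which is why the lengths tend to 0 along the enumeration.\<close>

lemma ex_small_separating_sets: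
  obtains I :: "nat \<Rightarrow> real set" where "\<And>i. I i \<in> sets borel"
    "(\<lambda>i. measure lborel ({0..<1} \<inter> I i)) \<longlonglongrightarrow> 0"
    "\<And>x y. 0 \<le> x \<Longrightarrow> x < y \<Longrightarrow> \<exists>i. x \<in> I i \<and> y \<notin> I i"
proof -
  define J where "J j l = {real l / Suc j ..< (real l + 1) / Suc j}" for j l
  define I where "I i = (case prod_decode i of (j, l) \<Rightarrow> J j l)" for i
  have J_le: "measure lborel ({0..<1} \<inter> J j l) \<le> 1 / Suc j" for j l
  proof -
    have "measure lborel ({0..<1} \<inter> J j l) \<le> measure lborel (J j l)"
      by (rule measure_mono_fmeasurable) (auto simp: J_def fmeasurable_def emeasure_lborel_Ico divide_right_mono)
    also have "\<dots> = 1 / Suc j" by (simp add: J_def divide_right_mono flip: diff_divide_distrib)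
    finally show ?thesis .
  qed
  have J_empty: "{0..<1} \<inter> J j l = {}" if "l > j" for j l
  proof -
    have "1 \<le> real l / Suc j" using that by (simp add: field_simps)
    then show ?thesis by (auto simp: J_def)
  qed
  show thesis
  proof
    show "I i \<in> sets borel" for i by (auto simp: I_def J_def split: prod.split)
    show "(\<lambda>i. measure lborel ({0..<1} \<inter> I i)) \<longlonglongrightarrow> 0"
    proof (rule order_tendstoI)
      fix e :: real assume "e > 0"
      then obtain N where N: "1 / real (Suc N) < e" using nat_approx_posE by blast
      have "{i. \<not> measure lborel ({0..<1} \<inter> I i) < e} \<subseteq> prod_encode ` ({..N} \<times> {..N})"
      proof
        fix i assume i: "i \<in> {i. \<not> measure lborel ({0..<1} \<inter> I i) < e}"
        obtain j l where jl: "prod_decode i = (j, l)" by fastforce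
        have large: "e \<le> measure lborel ({0..<1} \<inter> J j l)" using i by (simp add: I_def jl)
        have "l \<le> j" using large J_empty[of j l] \<open>e > 0\<close> by (cases "l \<le> j") auto
        moreover have "j \<le> N"
        proof (rule ccontr)
          assume "\<not> j \<le> N"
          then have "1 / real (Suc j) \<le> 1 / real (Suc N)" by (intro divide_left_mono) auto
          with large J_le[of j l] N show False by linarith
        qed
        moreover have "i = prod_encode (j, l)" by (simp flip: jl)
        ultimately show "i \<in> prod_encode ` ({..N} \<times> {..N})" by auto
      qed
      then show "\<forall>\<^sub>F i in sequentially. measure lborel ({0..<1} \<inter> I i) < e"
        unfolding cofinite_eq_sequentially[symmetric] eventually_cofinite by (rule finite_subset) simp
    next
      fix e :: real assume "e < 0"
      then show "\<forall>\<^sub>F i in sequentially. e < measure lborel ({0..<1} \<inter> I i)"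
        by (intro always_eventually allI) (rule less_le_trans[OF _ measure_nonneg])
    qed
    fix x y :: real assume xy: "0 \<le> x" "x < y"
    then obtain j where j: "1 / real (Suc j) < y - x" using nat_approx_posE[of "y - x"] by auto
    define l where "l = nat \<lfloor>x * Suc j\<rfloor>"
    have l: "real l = of_int \<lfloor>x * Suc j\<rfloor>" using xy by (simp add: l_def)
    have "x \<in> J j l" using of_int_floor_le[of "x * Suc j"] floor_correct[of "x * Suc j"]
      unfolding J_def l by (simp add: field_simps)
    moreover have "y \<notin> J j l"
    proof
      assume "y \<in> J j l"
      with \<open>x \<in> J j l\<close> have "y < (real l + 1) / Suc j" "real l / Suc j \<le> x" by (auto simp: J_def)
      with j show False by (simp add: add_divide_distrib)
    qed
    ultimately show "\<exists>i. x \<in> I i \<and> y \<notin> I i"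
      by (intro exI[of _ "prod_encode (j, l)"]) (simp add: I_def)
  qed
qed

lemma geometric_decay:
  fixes \<theta> :: "nat \<Rightarrow> real"
  assumes "\<And>i. 0 < \<theta> i" "\<And>i. \<theta> (Suc i) \<le> \<theta> i / 4"
  shows "\<theta> (j + i) \<le> \<theta> i * (1/4) ^ j" "summable \<theta>" "(\<Sum>j. \<theta> (j + i)) \<le> 4 / 3 * \<theta> i"
proof -
  show le: "\<theta> (j + i) \<le> \<theta> i * (1/4) ^ j" for i j
  proof (induction j)
    case (Suc j)
    then show ?case using assms(2)[of "j + i"] by simp
  qed simp
  have sg: "summable (\<lambda>j. \<theta> i * (1/4) ^ j)" for i by (intro summable_mult summable_geometric) simp
  have sm: "summable (\<lambda>j. \<theta> (j + i))" for i
    by (rule summable_comparison_test'[OF sg[of i], of 0]) (use le[of _ i] in \<open>simp add: abs_of_pos[OF assms(1)]\<close>)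
  show "summable \<theta>" using sm[of 0] by simp
  have "(\<Sum>j. \<theta> (j + i)) \<le> (\<Sum>j. \<theta> i * (1/4) ^ j)" by (rule suminf_le[OF le sm sg])
  also have "\<dots> = 4 / 3 * \<theta> i" by (subst suminf_mult) (auto simp: suminf_geometric)
  finally show "(\<Sum>j. \<theta> (j + i)) \<le> 4 / 3 * \<theta> i" .
qed

text \<open>At the first index \<open>i\<close> where \<open>A\<close> and \<open>B\<close> differ,
  the term \<open>\<theta> i\<close> outweighs the whole tail, which is at most
  \<open>\<theta> i / 3\<close>.\<close>

lemma subset_sums_distinct:
  fixes \<theta> :: "nat \<Rightarrow> real"
  assumes \<theta>: "\<And>i. 0 < \<theta> i" "\<And>i. \<theta> (Suc i) \<le> \<theta> i / 4"
    and "(\<Sum>i. \<theta> i * indicator A i) = (\<Sum>i. \<theta> i * indicator B i)"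
  shows "A = B"
proof (rule ccontr)
  assume "A \<noteq> B"
  then have ex: "\<exists>i. i \<in> A \<longleftrightarrow> i \<notin> B" by auto
  define i where "i = (LEAST i. i \<in> A \<longleftrightarrow> i \<notin> B)"
  have i: "i \<in> A \<longleftrightarrow> i \<notin> B" unfolding i_def by (rule LeastI_ex[OF ex])
  have less: "j \<in> A \<longleftrightarrow> j \<in> B" if "j < i" for j using not_less_Least[of j] that unfolding i_def by blast
  define g where "g j = \<theta> j * indicator A j - \<theta> j * indicator B j" for j
  note sm\<theta> = geometric_decay(2)[of \<theta>, OF \<theta>]
  have sm: "summable (\<lambda>j. \<theta> j * indicator C j)" for C
    by (rule summable_comparison_test[OF _ sm\<theta>]) (use \<theta>(1) less_imp_le in \<open>auto simp: indicator_def intro!: exI[of _ 0]\<close>)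
  have smg: "summable g" unfolding g_def by (intro summable_diff sm)
  have "0 = suminf g" unfolding g_def using assms(3) by (simp add: suminf_diff[OF sm sm, symmetric])
  also have "\<dots> = (\<Sum>j. g (j + Suc i)) + sum g {..<Suc i}" by (rule suminf_split_initial_segment[OF smg])
  also have "sum g {..<Suc i} = g i" using less by (simp add: g_def indicator_def)
  finally have "\<bar>g i\<bar> = \<bar>\<Sum>j. g (j + Suc i)\<bar>" by linarith
  also have "\<dots> \<le> (\<Sum>j. \<theta> (j + Suc i))"
  proof -
    have smt: "summable (\<lambda>j. \<theta> (j + Suc i))" by (rule summable_ignore_initial_segment[OF sm\<theta>])
    have "norm (g (j + Suc i)) \<le> \<theta> (j + Suc i)" for j using \<theta>(1)[of "j + Suc i"] by (auto simp: g_def indicator_def)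
    from norm_suminf_le[OF this smt] show ?thesis by simp
  qed
  also have "\<dots> \<le> 4 / 3 * \<theta> (Suc i)" by (rule geometric_decay(3)[of \<theta>, OF \<theta>])
  also have "\<dots> \<le> \<theta> i / 3" using \<theta>(2)[of i] by simp
  finally have "\<bar>g i\<bar> \<le> \<theta> i / 3" .
  moreover have "\<bar>g i\<bar> = \<theta> i" using i \<theta>(1)[of i] by (auto simp: g_def indicator_def)
  ultimately show False using \<theta>(1)[of i] by simp
qed

lemma cmod_cis_minus_one_le: "cmod (cis x - 1) \<le> \<bar>x\<bar>"
proof -
  have "(cmod (cis x - 1))\<^sup>2 = 4 * (sin (x / 2))\<^sup>2"
    using cos_double_sin[of "x / 2"] by (simp add: cmod_cis_minus_one)
  also have "\<dots> = (2 * \<bar>sin (x / 2)\<bar>)\<^sup>2" by (simp add: power_mult_distrib)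
  also have "\<dots> \<le> \<bar>x\<bar>\<^sup>2" using abs_sin_x_le_abs_x[of "x / 2"] by (intro power_mono) auto
  finally show ?thesis by (rule power2_le_imp_le) simp
qed

lemma cmod_cis_minus_one_le_2: "cmod (cis x - 1) \<le> 2"
  using norm_triangle_ineq4[of "cis x" 1] by simp

text \<open>Telescoping over partial sums; every prefactor \<open>cis\<close> has modulus 1.\<close>

lemma cmod_cis_sum_minus_one_le:
  fixes m :: nat
  shows "cmod (cis (\<Sum>i<m. f i) - 1) \<le> (\<Sum>i<m. cmod (cis (f i) - 1))"
proof (induction m)
  case (Suc m)
  have "cis ((\<Sum>i<m. f i) + f m) - 1 = cis (\<Sum>i<m. f i) * (cis (f m) - 1) + (cis (\<Sum>i<m. f i) - 1)"
    by (simp add: algebra_simps flip: cis_mult)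
  then have "cmod (cis ((\<Sum>i<m. f i) + f m) - 1) \<le> cmod (cis (f m) - 1) + cmod (cis (\<Sum>i<m. f i) - 1)"
    by (metis norm_triangle_ineq norm_mult norm_cis mult_1)
  with Suc show ?case by simp
qed simp

text \<open>Pairs of an angle and a time are chosen recursively: \<open>\<theta> i\<close> is good
  from time \<open>K i\<close> on, and \<open>\<theta> (Suc i)\<close> is so small that it is good
  before time \<open>K i\<close>. The bad times of \<open>\<theta> (Suc i)\<close> therefore lie
  between \<open>K i\<close> and \<open>K (Suc i)\<close>, and these windows are disjoint.\<close>

lemma ex_staggered_angles:
  fixes n :: "nat \<Rightarrow> int"
  assumes small: "\<And>d. d > 0 \<Longrightarrow> \<exists>t::real. 0 < t \<and> t < d \<and> (\<lambda>k. cis (n k * t)) \<longlonglongrightarrow> 1"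
  obtains \<theta> :: "nat \<Rightarrow> real" and b :: "nat \<Rightarrow> nat" where
    "\<And>i. 0 < \<theta> i" "\<And>i. \<theta> (Suc i) \<le> \<theta> i / 4" "\<theta> 0 < 1" "\<And>i. (\<lambda>k. cis (n k * \<theta> i)) \<longlonglongrightarrow> 1"
    "filterlim b at_top sequentially" "\<And>k i. i \<noteq> b k \<Longrightarrow> cmod (cis (n k * \<theta> i) - 1) \<le> (1/2) ^ i"
proof -
  define H where "H t \<longleftrightarrow> (\<lambda>k. cis (n k * t)) \<longlonglongrightarrow> 1" for t :: real
  let ?a = "\<lambda>(t::real) k. cmod (cis (n k * t) - 1)"
  have late: "\<exists>K\<ge>K0. \<forall>k\<ge>K. ?a t k \<le> (1/2) ^ i" if "H t" for t :: real and i and K0 :: nat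
  proof -
    have "\<forall>\<^sub>F k in sequentially. dist (cis (n k * t)) 1 < (1/2) ^ i"
      using that unfolding H_def by (rule tendstoD) simp
    then obtain K where "\<And>k. k \<ge> K \<Longrightarrow> ?a t k < (1/2) ^ i"
      unfolding eventually_sequentially dist_norm by blast
    then show ?thesis by (intro exI[of _ "max K K0"]) (auto intro: less_imp_le)
  qed
  define P where "P i u \<longleftrightarrow> H (fst u) \<and> 0 < fst u \<and> fst u < 1 \<and> (\<forall>k\<ge>snd u. ?a (fst u) k \<le> (1/2) ^ i)"
    for i :: nat and u :: "real \<times> nat"
  define Q where "Q i u v \<longleftrightarrow> fst v \<le> fst u / 4 \<and> snd u \<le> snd v \<and> (\<forall>k<snd u. ?a (fst v) k \<le> (1/2) ^ Suc i)"
    for i :: nat and u v :: "real \<times> nat"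
  have "\<exists>g. \<forall>i. P i (g i) \<and> Q i (g i) (g (Suc i))"
  proof (rule dependent_nat_choice)
    obtain t where t: "0 < t" "t < 1" "H t" using small[of 1] by (auto simp: H_def)
    obtain K where "\<forall>k\<ge>K. ?a t k \<le> (1/2) ^ 0" using late[OF t(3)] by blast
    with t show "\<exists>u. P 0 u" by (intro exI[of _ "(t, K)"]) (simp add: P_def)
  next
    fix u i assume u: "P i u"
    define T where "T = 1 + (\<Sum>k<snd u. \<bar>real_of_int (n k)\<bar>)"
    have T: "T > 0" unfolding T_def by (intro add_pos_nonneg sum_nonneg) auto
    \<comment> \<open>The first bound gives the decay; the second makes
      \<open>\<bar>n k * t\<bar>\<close>, hence the chord, small for the finitely many
      \<open>k < snd u\<close>.\<close>
    define d where "d = min (fst u / 4) ((1/2) ^ Suc i / T)"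
    have "d > 0" using u T by (simp add: d_def P_def)
    then obtain t where t: "0 < t" "t < d" "H t" using small[of d] by (auto simp: H_def)
    have early: "?a t k \<le> (1/2) ^ Suc i" if "k < snd u" for k
    proof -
      have "\<bar>real_of_int (n k)\<bar> \<le> (\<Sum>k<snd u. \<bar>real_of_int (n k)\<bar>)"
        using that by (intro member_le_sum) auto
      then have nT: "\<bar>real_of_int (n k)\<bar> \<le> T" by (simp add: T_def)
      have "?a t k \<le> \<bar>n k * t\<bar>" by (rule cmod_cis_minus_one_le)
      also have "\<dots> = \<bar>real_of_int (n k)\<bar> * t" using t by (simp add: abs_mult)
      also have "\<dots> \<le> T * ((1/2) ^ Suc i / T)" using nT t T by (intro mult_mono) (auto simp: d_def)
      finally show ?thesis using T by simp
    qed
    obtain K where "K \<ge> snd u" "\<forall>k\<ge>K. ?a t k \<le> (1/2) ^ Suc i" using late[OF t(3)] by blast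
    with t early u show "\<exists>v. P (Suc i) v \<and> Q i u v"
      by (intro exI[of _ "(t, K)"]) (auto simp: P_def Q_def d_def)
  qed
  then obtain g where g: "\<And>i. P i (g i)" "\<And>i. Q i (g i) (g (Suc i))" by blast
  define \<theta> where "\<theta> i = fst (g i)" for i
  define K where "K i = snd (g i)" for i
  have H: "H (\<theta> i)" for i using g(1)[of i] by (simp add: P_def \<theta>_def)
  have late': "?a (\<theta> i) k \<le> (1/2) ^ i" if "k \<ge> K i" for i k using g(1)[of i] that by (simp add: P_def \<theta>_def K_def)
  have early': "?a (\<theta> (Suc i)) k \<le> (1/2) ^ Suc i" if "k < K i" for i k using g(2)[of i] that by (simp add: Q_def \<theta>_def K_def)
  have K_mono: "K i \<le> K j" if "i \<le> j" for i j
    by (rule lift_Suc_mono_le[OF _ that]) (use g(2) in \<open>simp add: Q_def K_def\<close>)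
  define bad where "bad k i \<longleftrightarrow> \<not> ?a (\<theta> i) k \<le> (1/2) ^ i" for k i
  have bad_unique: "i = j" if "bad k i" "bad k j" for k i j
  proof -
    have False if "bad k i" "bad k j" "i < j" for i j
    proof -
      obtain j' where j': "j = Suc j'" "i \<le> j'" using \<open>i < j\<close> by (cases j) auto
      have "k < K i" using late'[of i k] that(1) by (force simp: bad_def)
      also have "K i \<le> K j'" by (rule K_mono[OF j'(2)])
      finally show False using early'[of k j'] that(2) by (simp add: bad_def j'(1))
    qed
    with that show ?thesis by (metis linorder_neqE_nat)
  qed
  \<comment> \<open>When no index is bad, the default \<open>k\<close> keeps \<open>b\<close>
    tending to infinity.\<close>
  define b where "b k = (if \<exists>i. bad k i then THE i. bad k i else k)" for k
  have b_eq: "b k = i" if "bad k i" for k i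
    using that bad_unique unfolding b_def by (auto intro!: the_equality)
  show thesis
  proof
    show "0 < \<theta> i" for i using g(1)[of i] by (simp add: P_def \<theta>_def)
    show "\<theta> (Suc i) \<le> \<theta> i / 4" for i using g(2)[of i] by (simp add: Q_def \<theta>_def)
    show "\<theta> 0 < 1" using g(1)[of 0] by (simp add: P_def \<theta>_def)
    show "(\<lambda>k. cis (n k * \<theta> i)) \<longlonglongrightarrow> 1" for i using H[of i] by (simp add: H_def)
    show "?a (\<theta> i) k \<le> (1/2) ^ i" if "i \<noteq> b k" for k i
      using b_eq[of k i] that by (auto simp: bad_def)
    show "filterlim b at_top sequentially"
      unfolding filterlim_at_top eventually_sequentially
    proof (intro allI exI impI)
      fix Z k :: nat assume k: "max Z (K Z) \<le> k"
      show "Z \<le> b k"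
      proof (cases "\<exists>i. bad k i")
        case True
        then obtain i where i: "bad k i" by blast
        have "\<not> i < Z" using i late'[of i k] K_mono[of i Z] k by (force simp: bad_def)
        then show ?thesis using b_eq[OF i] by simp
      qed (use k in \<open>simp add: b_def\<close>)
    qed
  qed
qed

lemma rigidity_sequence_if_small_angles:
  fixes n :: "nat \<Rightarrow> int"
  assumes "\<And>d. d > 0 \<Longrightarrow> \<exists>t::real. 0 < t \<and> t < d \<and> (\<lambda>k. cis (n k * t)) \<longlonglongrightarrow> 1"
  shows "rigidity_sequence n"
proof -
  obtain \<theta> :: "nat \<Rightarrow> real" and b :: "nat \<Rightarrow> nat" where
    \<theta>: "\<And>i. 0 < \<theta> i" "\<And>i. \<theta> (Suc i) \<le> \<theta> i / 4" "\<theta> 0 < 1" "\<And>i. (\<lambda>k. cis (n k * \<theta> i)) \<longlonglongrightarrow> 1"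
    and b: "filterlim b at_top sequentially" "\<And>k i. i \<noteq> b k \<Longrightarrow> cmod (cis (n k * \<theta> i) - 1) \<le> (1/2) ^ i"
    using ex_staggered_angles[OF assms] by metis
  obtain I :: "nat \<Rightarrow> real set" where I [measurable]: "\<And>i. I i \<in> sets borel"
    and I_small: "(\<lambda>i. measure lborel ({0..<1} \<inter> I i)) \<longlonglongrightarrow> 0"
    and I_sep: "\<And>x y. 0 \<le> x \<Longrightarrow> x < y \<Longrightarrow> \<exists>i. x \<in> I i \<and> y \<notin> I i"
    using ex_small_separating_sets by blast
  define M where "M = uniform_measure lborel {0..<1::real}"
  have sets_M [measurable_cong]: "sets M = sets borel" by (simp add: M_def)
  interpret M: prob_space M unfolding M_def by (rule prob_space_uniform_measure) auto
  have meas_M: "measure M A = measure lborel ({0..<1} \<inter> A)" if "A \<in> sets borel" for A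
    unfolding M_def by (subst measure_uniform_measure) (use that in auto)
  define S where "S x = (\<Sum>i. \<theta> i * indicator (I i) x)" for x
  have S_meas [measurable]: "S \<in> borel_measurable M" unfolding S_def by measurable
  have sm: "summable (\<lambda>i. \<theta> i * indicator (I i) x)" for x
    by (rule summable_comparison_test[OF _ geometric_decay(2)[of \<theta>, OF \<theta>(1,2)]])
       (use \<theta>(1) less_imp_le in \<open>auto simp: indicator_def intro!: exI[of _ 0]\<close>)
  have S_range: "0 \<le> S x" "S x < 2 * pi" for x
  proof -
    show "0 \<le> S x" unfolding S_def by (rule suminf_nonneg[OF sm]) (simp add: less_imp_le[OF \<theta>(1)])
    have "S x \<le> (\<Sum>i. \<theta> i)" unfolding S_def
      by (rule suminf_le[OF _ sm geometric_decay(2)[of \<theta>, OF \<theta>(1,2)]]) (use \<theta>(1) less_imp_le in \<open>auto simp: indicator_def\<close>)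
    also have "\<dots> \<le> 4 / 3 * \<theta> 0" using geometric_decay(3)[of \<theta> 0, OF \<theta>(1,2)] by simp
    also have "\<dots> < 2 * pi" using \<theta>(3) pi_gt3 by linarith
    finally show "S x < 2 * pi" .
  qed
  \<comment> \<open>As \<open>S\<close> takes values in \<open>[0, 2 * pi)\<close>,
    \<open>cis\<close> loses no information; the subset sum determines which \<open>I i\<close>
    contain \<open>x\<close>, and these determine \<open>x\<close>.\<close>
  have S_inj: "x = y" if "x \<in> {0..<1}" "y \<in> {0..<1}" "cis (S x) = cis (S y)" for x y
  proof -
    have "sin (S x) = sin (S y) \<and> cos (S x) = cos (S y)" using that(3) by (simp add: complex_eq_iff)
    then obtain m :: int where m: "S x = S y + 2 * pi * m" unfolding sin_cos_eq_iff by blast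
    then have "\<bar>2 * pi * m\<bar> < 2 * pi * 1" using S_range[of x] S_range[of y] by linarith
    then have "m = 0" by (simp add: abs_mult)
    with m have "S x = S y" by simp
    then have "{i. x \<in> I i} = {i. y \<in> I i}"
      by (intro subset_sums_distinct[of \<theta>, OF \<theta>(1,2)]) (simp add: S_def indicator_def)
    then show ?thesis using I_sep[of x y] I_sep[of y x] that(1,2)
      by (cases x y rule: linorder_cases) auto
  qed
  show ?thesis
  proof (rule rigidity_sequenceI[OF M.prob_space_axioms S_meas])
    fix z
    have "(\<lambda>x. cis (S x)) \<in> borel_measurable M"
      by (intro borel_measurable_continuous_on[where f=cis] S_meas continuous_intros)
    then have meas: "{x. cis (S x) = z} \<in> sets borel"
      using measurable_sets[of "\<lambda>x. cis (S x)" M borel "{z}"] by (simp add: vimage_def sets_M M_def)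
    have "measure lborel ({0..<1} \<inter> {x. cis (S x) = z}) = 0"
    proof (cases "{0..<1} \<inter> {x. cis (S x) = z} = {}")
      case False
      then obtain x where "x \<in> {0..<1}" "cis (S x) = z" by blast
      then have "{0..<1} \<inter> {x. cis (S x) = z} = {x}" using S_inj by auto
      then show ?thesis by (simp add: measure_def)
    qed simp
    then show "measure M {x \<in> space M. cis (S x) = z} = 0"
      using meas_M[OF meas] by (simp add: M_def)
  next
    \<comment> \<open>Truncating at \<open>(1/2) ^ i\<close> changes nothing at good indices and
      provides the summable bound for Tannery's theorem.\<close>
    define c where "c i k = min (cmod (cis (n k * \<theta> i) - 1)) ((1/2) ^ i)" for i k
    have c_nonneg: "0 \<le> c i k" for i k by (simp add: c_def)
    have c_le: "c i k \<le> (1/2) ^ i" for i k by (simp add: c_def)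
    have sm_half: "summable (\<lambda>i. (1/2 :: real) ^ i)" by (intro summable_geometric) simp
    have sm_c: "summable (\<lambda>i. c i k)" for k
      by (rule summable_comparison_test[OF _ sm_half]) (use c_nonneg c_le in auto)
    have c_lim: "(\<lambda>k. \<Sum>i. c i k) \<longlonglongrightarrow> 0"
    proof -
      have "(\<lambda>k. c i k) \<longlonglongrightarrow> 0" for i
      proof -
        have "(\<lambda>k. c i k) \<longlonglongrightarrow> min (cmod (1 - 1)) ((1/2) ^ i)" unfolding c_def by (intro tendsto_intros \<theta>(4))
        then show ?thesis by simp
      qed
      moreover have "\<forall>\<^sub>F (i, k) in at_top \<times>\<^sub>F sequentially. norm (c i k) \<le> (1/2) ^ i"
        by (intro always_eventually) (use c_nonneg c_le in auto)
      ultimately have "(\<lambda>k. \<Sum>i. c i k) \<longlonglongrightarrow> (\<Sum>i. 0)"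
        using tannerys_theorem[of c "\<lambda>_. 0" sequentially "\<lambda>i. (1/2) ^ i"] sm_half trivial_limit_sequentially by blast
      then show ?thesis by simp
    qed
    \<comment> \<open>The possibly bad index \<open>b k\<close> costs at most 2 beyond its truncated
      term, and only when \<open>x\<close> lies in \<open>I (b k)\<close>.\<close>
    have pointwise: "1 - cos (n k * S x) \<le> (\<Sum>i. c i k) + 2 * indicator (I (b k)) x" for k x
    proof -
      have part: "cmod (cis (n k * (\<Sum>i<m. \<theta> i * indicator (I i) x)) - 1) \<le> (\<Sum>i. c i k) + 2 * indicator (I (b k)) x" for m
      proof -
        have "cmod (cis (n k * (\<Sum>i<m. \<theta> i * indicator (I i) x)) - 1)
            \<le> (\<Sum>i<m. cmod (cis (n k * (\<theta> i * indicator (I i) x)) - 1))"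
          unfolding sum_distrib_left by (rule cmod_cis_sum_minus_one_le)
        also have "\<dots> \<le> (\<Sum>i<m. c i k + (if i = b k then 2 * indicator (I (b k)) x else 0))"
        proof (rule sum_mono)
          fix i
          show "cmod (cis (n k * (\<theta> i * indicator (I i) x)) - 1) \<le> c i k + (if i = b k then 2 * indicator (I (b k)) x else 0)"
          proof (cases "x \<in> I i")
            case True
            show ?thesis
            proof (cases "i = b k")
              case True
              then show ?thesis using \<open>x \<in> I i\<close> cmod_cis_minus_one_le_2[of "n k * \<theta> i"] c_nonneg[of i k] by simp
            next
              case False
              then show ?thesis using \<open>x \<in> I i\<close> b(2)[OF False] by (simp add: c_def)
            qed
          qed (use c_nonneg in simp)
        qed
        also have "\<dots> \<le> (\<Sum>i. c i k) + 2 * indicator (I (b k)) x"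
          unfolding sum.distrib
        proof (rule add_mono)
          show "(\<Sum>i<m. c i k) \<le> (\<Sum>i. c i k)" by (rule sum_le_suminf[OF sm_c]) (use c_nonneg in auto)
          show "(\<Sum>i<m. if i = b k then 2 * indicator (I (b k)) x else 0) \<le> 2 * (indicator (I (b k)) x :: real)"
            by simp
        qed
        finally show ?thesis .
      qed
      \<comment> \<open>The estimate for finite sums passes to the limit, its right-hand side being
        independent of \<open>m\<close>.\<close>
      have "(\<lambda>m. \<Sum>i<m. \<theta> i * indicator (I i) x) \<longlonglongrightarrow> S x" unfolding S_def by (rule summable_LIMSEQ[OF sm])
      then have "(\<lambda>m. cmod (cis (n k * (\<Sum>i<m. \<theta> i * indicator (I i) x)) - 1)) \<longlonglongrightarrow> cmod (cis (n k * S x) - 1)"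
        by (intro tendsto_intros)
      then have "cmod (cis (n k * S x) - 1) \<le> (\<Sum>i. c i k) + 2 * indicator (I (b k)) x"
        by (rule LIMSEQ_le_const2) (use part in blast)
      moreover have "1 - cos (n k * S x) \<le> cmod (cis (n k * S x) - 1)"
        using abs_Re_le_cmod[of "cis (n k * S x) - 1"] by simp
      ultimately show ?thesis by linarith
    qed
    show "(\<lambda>k. \<integral>x. 1 - cos (n k * S x) \<partial>M) \<longlonglongrightarrow> 0"
    proof (rule tendsto_sandwich[OF _ _ tendsto_const])
      show "\<forall>\<^sub>F k in sequentially. 0 \<le> (\<integral>x. 1 - cos (n k * S x) \<partial>M)" by (intro always_eventually allI integral_nonneg) simp
      have "(\<integral>x. 1 - cos (n k * S x) \<partial>M) \<le> (\<Sum>i. c i k) + 2 * measure lborel ({0..<1} \<inter> I (b k))" for k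
      proof -
        have int_I: "integrable M (indicator (I (b k)) :: real \<Rightarrow> real)"
          by (rule integrable_real_indicator) (auto simp: M.emeasure_eq_measure)
        have "(\<integral>x. 1 - cos (n k * S x) \<partial>M) \<le> (\<integral>x. (\<Sum>i. c i k) + 2 * indicator (I (b k)) x \<partial>M)"
        proof (rule integral_mono[OF _ _ pointwise])
          show "integrable M (\<lambda>x. 1 - cos (n k * S x))"
            by (rule M.integrable_const_bound[where B=2]) (auto simp: abs_le_iff intro: order_trans[OF _ cos_ge_minus_one] order_trans[OF cos_le_one])
        qed (use int_I in simp)
        also have "\<dots> = (\<Sum>i. c i k) + 2 * measure M (I (b k))" using int_I by (simp add: M.prob_space)
        finally show ?thesis by (simp add: meas_M)
      qed
      then show "\<forall>\<^sub>F k in sequentially. (\<integral>x. 1 - cos (n k * S x) \<partial>M) \<le> (\<Sum>i. c i k) + 2 * measure lborel ({0..<1} \<inter> I (b k))" by simp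
      show "(\<lambda>k. (\<Sum>i. c i k) + 2 * measure lborel ({0..<1} \<inter> I (b k))) \<longlonglongrightarrow> 0"
        using tendsto_add[OF c_lim tendsto_mult_right_zero[OF filterlim_compose[OF I_small b(1)], of 2]] by simp
    qed
  qed
qed

section \<open>Dichotomy: arbitrarily small angles or a gap above 0\<close>

theorem theorem3p8:
  fixes n :: "nat \<Rightarrow> int"
  assumes "TB_sequence n"
  shows "rigidity_sequence n"
proof (cases "\<forall>d>0. \<exists>t::real>0. t < d \<and> (\<lambda>k. cis (n k * t)) \<longlonglongrightarrow> 1")
  case True
  then show ?thesis by (intro rigidity_sequence_if_small_angles) blast
next
  case False
  then obtain \<delta> where "\<delta> > 0" "\<And>t::real. 0 < t \<Longrightarrow> t < \<delta> \<Longrightarrow> \<not> (\<lambda>k. cis (n k * t)) \<longlonglongrightarrow> 1" by blast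
  from annihilator_if_no_small_angles[OF this]
  obtain q :: int where "q > 0" "\<And>t::real. (\<lambda>k. cis (n k * t)) \<longlonglongrightarrow> 1 \<Longrightarrow> cis (q * t) = 1" by blast
  moreover obtain \<tau> where "precompact_group_topology \<tau>" "limitin \<tau> n 0 sequentially"
    using assms by (auto simp: TB_sequence_def)
  ultimately show ?thesis by (intro rigidity_sequence_if_annihilated)
qed

end
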